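(* Let $X$ be a metrizable compact Hausdorff space containing more than one point, and let $\mu_{OH} X : OH^2(X)\to OH(X)$ be the multiplication map of the monad $\mathbb{OH}$ of positively homogeneous functionals. Then $\mu_{OH} X$ is a $Q$-fibration, where $Q=[0,1]^\omega$ is the Hilbert cube; that is, there is a homeomorphism $h: OH^2(X)\to Q\times OH(X)$ such that $p\circ h=\mu_{OH} X$, where $p:Q\times OH(X)\to OH(X)$ is the projection.
   Context: All spaces are compact Hausdorff and all maps between them are continuous. For a compact Hausdorff space $X$, $C(X)$ is the Banach space of continuous real-valued functions on $X$ with the sup-norm, and $c_X$ is the constant function with value $c\in\mathbb{R}$. $OH(X)$ is the set of all functionals $\nu:C(X)\to\mathbb{R}$ (not assumed linear) that are: 1) normed: $\nu(1_X)=1$; 2) weakly additive: $\nu(\varphi+c_X)=\nu(\varphi)+c$ for all $\varphi\in C(X)$, $c\in\mathbb{R}$; 3) order-preserving: $\varphi\le\psi$ pointwise implies $\nu(\varphi)\le\nu(\psi)$; 4) positively homogeneous: $\nu(t\varphi)=t\nu(\varphi)$ for all $\varphi\in C(X)$ and real $t\ge 0$. $OH(X)$ is topologized as a subspace of the product $V(X)=\prod_{\varphi\in C(X)}[\min\varphi,\max\varphi]$ (topology of pointwise convergence); it is a compact Hausdorff space. Put $OH^2(X)=OH(OH(X))$. The multiplication map $\mu_{OH} X:OH^2(X)\to OH(X)$ is defined by $\mu_{OH} X(M)(\varphi)=M(\pi_\varphi)$ for $M\in OH^2(X)$, $\varphi\in C(X)$, where $\pi_\varphi\in C(OH(X))$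 is given by $\pi_\varphi(\lambda)=\lambda(\varphi)$. *)

theory Defs
  imports "HOL-Analysis.Analysis"
begin

text \<open>
  Spaces are values of type \<^typ>\<open>'a topology\<close>. Functions and functionals are only meaningful on
  their domain, so they are normalised to be \<^const>\<open>extensional\<close>; this makes equality of
  elements coincide with equality of the underlying maps.
\<close>

definition CX :: "'a topology \<Rightarrow> ('a \<Rightarrow> real) set" where
  "CX X = {\<phi>. continuous_map X euclideanreal \<phi>} \<inter> extensional (topspace X)"

definition normed :: "'a topology \<Rightarrow> (('a \<Rightarrow> real) \<Rightarrow> real) \<Rightarrow> bool" where
  "normed X \<nu> \<longleftrightarrow> \<nu> (\<lambda>x\<in>topspace X. 1) = 1"

definition weakly_additive :: "'a topology \<Rightarrow> (('a \<Rightarrow> real) \<Rightarrow> real) \<Rightarrow> bool" where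
  "weakly_additive X \<nu> \<longleftrightarrow>
     (\<forall>\<phi>\<in>CX X. \<forall>c::real. \<nu> (\<lambda>x\<in>topspace X. \<phi> x + c) = \<nu> \<phi> + c)"

definition order_preserving :: "'a topology \<Rightarrow> (('a \<Rightarrow> real) \<Rightarrow> real) \<Rightarrow> bool" where
  "order_preserving X \<nu> \<longleftrightarrow>
     (\<forall>\<phi>\<in>CX X. \<forall>\<psi>\<in>CX X. (\<forall>x\<in>topspace X. \<phi> x \<le> \<psi> x) \<longrightarrow> \<nu> \<phi> \<le> \<nu> \<psi>)"

definition positively_homogeneous :: "'a topology \<Rightarrow> (('a \<Rightarrow> real) \<Rightarrow> real) \<Rightarrow> bool" where
  "positively_homogeneous X \<nu> \<longleftrightarrow>
     (\<forall>\<phi>\<in>CX X. \<forall>t::real. t \<ge> 0 \<longrightarrow> \<nu> (\<lambda>x\<in>topspace X. t * \<phi> x) = t * \<nu> \<phi>)"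

definition OH_set :: "'a topology \<Rightarrow> (('a \<Rightarrow> real) \<Rightarrow> real) set" where
  "OH_set X = {\<nu> \<in> extensional (CX X).
     normed X \<nu> \<and> weakly_additive X \<nu> \<and> order_preserving X \<nu> \<and> positively_homogeneous X \<nu>}"

text \<open>
  On a nonempty compact space the infimum and supremum below are the minimum and maximum.
\<close>

definition V :: "'a topology \<Rightarrow> (('a \<Rightarrow> real) \<Rightarrow> real) topology" where
  "V X = product_topology
     (\<lambda>\<phi>. top_of_set {(INF x\<in>topspace X. \<phi> x)..(SUP x\<in>topspace X. \<phi> x)}) (CX X)"

definition OH :: "'a topology \<Rightarrow> (('a \<Rightarrow> real) \<Rightarrow> real) topology" where
  "OH X = subtopology (V X) (OH_set X)"

definition evaluation :: "'a topology \<Rightarrow> ('a \<Rightarrow> real) \<Rightarrow> (('a \<Rightarrow> real) \<Rightarrow> real) \<Rightarrow> real" where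
  "evaluation X \<phi> = (\<lambda>\<nu>\<in>topspace (OH X). \<nu> \<phi>)"

definition mu_OH ::
  "'a topology \<Rightarrow> (((('a \<Rightarrow> real) \<Rightarrow> real) \<Rightarrow> real) \<Rightarrow> real) \<Rightarrow> ('a \<Rightarrow> real) \<Rightarrow> real" where
  "mu_OH X M = (\<lambda>\<phi>\<in>CX X. M (evaluation X \<phi>))"

definition Hilbert_cube :: "(nat \<Rightarrow> real) topology" where
  "Hilbert_cube = product_topology (\<lambda>_. top_of_set {0..1}) UNIV"

definition Q_fibration :: "'a topology \<Rightarrow> 'b topology \<Rightarrow> ('a \<Rightarrow> 'b) \<Rightarrow> bool" where
  "Q_fibration S T f \<longleftrightarrow>
     (\<exists>h. homeomorphic_map S (prod_topology Hilbert_cube T) h \<and>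
          (\<forall>s\<in>topspace S. snd (h s) = f s))"

end

(* A functional in OH(Y) is the same as a function on C(Y) that satisfies a family of inequalities,
   each relating its values at just two points of C(Y). Hence a functional known on a set A of test
   functions extends to one more function F with any prescribed value between a lower and an upper
   bound: the extreme extensions exist, and OH(Y) is convex. For Y = OH(X), let A consist of the
   evaluations, whose values are the data of mu(M), and finitely many functions treated earlier.
   The bounds depend continuously on M: the minorants of F in A can, up to epsilon, be
   replaced by finitely many of them (partitions of unity, Dickson's lemma).

   Treat alternately the members f_n of a determining sequence, for which the interval of possible
   values may degenerate, and functions g_n whose interval is always [0,1], namely functions that vanish
   at a maximum point and equal 1 at a minimum point of everything treated before. The n-th possibly
   degenerate interval is absorbed by the coordinates M(g_k), k = <n,j>, j = 0,1,..., through a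
   homeomorphism of [0,w] x Q onto Q depending continuously on w >= 0. As <n,j> >= n, the
   resulting coordinates can be decoded one after the other, so that with mu(M) they form a continuous
   bijection of compact Hausdorff spaces. *)
theory Submission
  imports Defs
begin

section \<open>Absorbing an interval of variable length into the Hilbert cube\<close>

text \<open>The obstacle is degeneracy. The natural coordinate of M at f_n is its relative position
  in the interval of admissible values, but the length w of that interval may vanish for some M and
  not for others, and then relative position need not extend continuously. Hence the interval is
  inserted among spare coordinates, at a place that recedes to infinity as w tends to 0. The spare
  coordinates have to be free for every M. All evaluations attain their maximum at one common point,
  the maximum functional on X, and their minimum at the minimum functional; these differ because X
  has two points. Each other function treated earlier has to leave a choice of extreme points, so
  such functions are flattened near their extremes, and convexity of OH(X) makes the flat parts
  infinite. Metrizability enters through a countable family separating the points of X, from which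
  the determining sequence is built.\<close>

definition box_norm :: "complex \<Rightarrow> real" where
  "box_norm z = max \<bar>Re z\<bar> \<bar>Im z\<bar>"

text \<open>Rotation by \<open>\<theta>\<close> conjugated so that it preserves the square; at \<open>z = 0\<close> the quotient is
  \<open>0/0 = 0\<close>, harmlessly.\<close>
definition square_rot :: "real \<Rightarrow> complex \<Rightarrow> complex" where
  "square_rot \<theta> z = (box_norm z / box_norm (cis \<theta> * z)) *\<^sub>R (cis \<theta> * z)"

lemma box_norm_nonneg: "0 \<le> box_norm z"
  by (simp add: box_norm_def)

lemma box_norm_eq_0: "box_norm z = 0 \<longleftrightarrow> z = 0"
  by (auto simp: box_norm_def complex_eq_iff max_def)

lemma box_norm_scaleR: "box_norm (r *\<^sub>R z) = \<bar>r\<bar> * box_norm z"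
  by (simp add: box_norm_def abs_mult max_mult_distrib_left)

lemma box_norm_square_rot [simp]: "box_norm (square_rot \<theta> z) = box_norm z"
proof (cases "z = 0")
  case False
  then have "box_norm (cis \<theta> * z) \<noteq> 0" by (simp add: box_norm_eq_0)
  then show ?thesis
    using box_norm_nonneg[of z] box_norm_nonneg[of "cis \<theta> * z"] unfolding square_rot_def
    by (simp add: box_norm_scaleR)
qed (simp add: square_rot_def)

lemma square_rot_0 [simp]: "square_rot 0 z = z"
  by (cases "z = 0") (auto simp: square_rot_def box_norm_eq_0)

text \<open>A quarter turn maps the square to itself, so no rescaling takes place. In
  \<open>absorb\<close> this is the state in which the new coordinate is emitted, negated, and the
  carried one is passed on.\<close>

lemma square_rot_pi_half: "square_rot (pi/2) (Complex a b) = Complex (- b) a"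
proof (cases "Complex a b = 0")
  case False
  have "box_norm (Complex (-b) a) = box_norm (Complex a b)" "\<i> * Complex a b = Complex (-b) a"
    by (auto simp: box_norm_def complex_eq_iff)
  with False show ?thesis by (simp add: square_rot_def box_norm_eq_0)
qed (auto simp: square_rot_def complex_eq_iff)

lemma square_rot_inverse: "square_rot (- \<theta>) (square_rot \<theta> z) = z"
proof (cases "z = 0")
  case False
  have 1: "cis (- \<theta>) * square_rot \<theta> z = (box_norm z / box_norm (cis \<theta> * z)) *\<^sub>R z" (is "_ = ?r *\<^sub>R z")
    by (simp add: square_rot_def cis_mult mult.assoc[symmetric])
  have "?r > 0" using False box_norm_nonneg[of z] box_norm_nonneg[of "cis \<theta> * z"]
    by (metis box_norm_eq_0 cis_neq_zero divide_pos_pos less_eq_real_def mult_eq_0_iff)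
  moreover have "box_norm z > 0"
    using False box_norm_nonneg[of z] by (metis box_norm_eq_0 less_eq_real_def)
  ultimately show ?thesis
    unfolding square_rot_def[of "-\<theta>"] 1 box_norm_scaleR by (simp add: abs_of_pos box_norm_eq_0 del: abs_divide zero_less_divide_iff)
qed (simp add: square_rot_def)

lemma continuous_on_box_norm: "continuous_on S box_norm"
  unfolding box_norm_def by (intro continuous_intros)

text \<open>Joint continuity is in question only at \<open>z = 0\<close>, where the quotient breaks
  down. There the angle is irrelevant: the modulus of the value is at most twice the preserved
  \<open>box_norm z\<close>.\<close>

lemma continuous_on_square_rot:
  assumes f: "continuous_on S f" and g: "continuous_on S g"
  shows "continuous_on S (\<lambda>x. square_rot (f x) (g x))"
proof -
  have "isCont (\<lambda>p. square_rot (fst p) (snd p)) p" for p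
  proof (cases "snd p = 0")
    case True
    have bound: "norm (square_rot t z) \<le> 2 * box_norm z" for t z
      using cmod_le[of "square_rot t z"] box_norm_square_rot[of t z]
        max.cobounded1[of "\<bar>Re (square_rot t z)\<bar>" "\<bar>Im (square_rot t z)\<bar>"]
        max.cobounded2[of "\<bar>Im (square_rot t z)\<bar>" "\<bar>Re (square_rot t z)\<bar>"]
      unfolding box_norm_def by linarith
    have "isCont (\<lambda>p::real\<times>complex. 2 * box_norm (snd p)) p"
      using continuous_on_box_norm[of UNIV]
      by (intro continuous_intros) (simp add: continuous_on_eq_continuous_at isCont_o2)
    then have "((\<lambda>p::real\<times>complex. 2 * box_norm (snd p)) \<longlongrightarrow> 0) (at p)"
      using True by (simp add: isCont_def box_norm_eq_0[THEN iffD2])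
    then have "((\<lambda>p. square_rot (fst p) (snd p)) \<longlongrightarrow> 0) (at p)"
      by (rule Lim_null_comparison[rotated]) (simp add: bound)
    then show ?thesis using True by (simp add: isCont_def square_rot_def)
  next
    case False
    have bn: "isCont box_norm z" for z
      using continuous_on_box_norm[of UNIV] by (simp add: continuous_on_eq_continuous_at)
    show ?thesis unfolding square_rot_def cis.ctr Complex_eq using False
      by (intro continuous_intros isCont_o2[OF _ bn]) (auto simp: box_norm_eq_0 Complex_eq[symmetric] cis.ctr[symmetric])
  qed
  then have "continuous_on UNIV (\<lambda>p. square_rot (fst p) (snd p))"
    by (simp add: continuous_at_imp_continuous_on)
  from continuous_on_compose2[OF this continuous_on_Pair[OF f g]] show ?thesis by simp
qed

text \<open>The interval \<open>[0,w]\<close> is inserted into the Hilbert cube at about position \<open>1/w\<close>: step \<open>n\<close> feeds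
  the carried coordinate and the \<open>n\<close>-th one into a square rotation whose angle is \<open>pi/2\<close> (carry on)
  for \<open>n + 1 \<le> 1/w\<close> and \<open>0\<close> (shift) for \<open>n + 1 \<ge> 2/w\<close>. As \<open>w\<close> tends to \<open>0\<close> the position escapes
  to infinity, which gives continuity there.\<close>
definition insert_angle :: "real \<Rightarrow> nat \<Rightarrow> real" where
  "insert_angle w n = pi / 2 * max 0 (min 1 (2 - real (Suc n) * w))"

text \<open>Coordinates are rescaled from \<open>[0,1]\<close> to \<open>[-1,1]\<close>. For
  \<open>w = 0\<close> the division gives 0 and the carry starts at -1; this value is never emitted,
  since all angles are then \<open>pi/2\<close>.\<close>

fun carry :: "real \<Rightarrow> real \<Rightarrow> (nat \<Rightarrow> real) \<Rightarrow> nat \<Rightarrow> real" where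
  "carry w t s 0 = 2 * (t / w) - 1"
| "carry w t s (Suc n) = Im (square_rot (insert_angle w n) (Complex (carry w t s n) (2 * s n - 1)))"

definition absorb :: "real \<Rightarrow> real \<Rightarrow> (nat \<Rightarrow> real) \<Rightarrow> nat \<Rightarrow> real" where
  "absorb w t s n =
     (1 + Re (square_rot (insert_angle w n) (Complex (carry w t s n) (2 * s n - 1)))) / 2"

abbreviation cube :: "(nat \<Rightarrow> real) set" where
  "cube \<equiv> {s. \<forall>i. s i \<in> {0..1}}"

lemma insert_angle_small: "real (Suc n) * w \<le> 1 \<Longrightarrow> insert_angle w n = pi / 2"
  by (simp add: insert_angle_def)

lemma insert_angle_large: "2 \<le> real (Suc n) * w \<Longrightarrow> insert_angle w n = 0"
  by (simp add: insert_angle_def)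

lemma square_rot_carry:
  "square_rot (insert_angle w n) (Complex (carry w t s n) (2 * s n - 1)) =
     Complex (2 * absorb w t s n - 1) (carry w t s (Suc n))"
  by (simp add: absorb_def complex_eq_iff field_simps)

text \<open>Such a coordinate depends on neither \<open>w\<close> nor \<open>t\<close>. As
  \<open>w\<close> tends to 0, every coordinate eventually takes this form, which is what makes
  \<open>absorb\<close> continuous at \<open>w = 0\<close>.\<close>

lemma absorb_small: "real (Suc n) * w \<le> 1 \<Longrightarrow> absorb w t s n = 1 - s n"
  unfolding absorb_def by (simp only: insert_angle_small square_rot_pi_half) (simp add: field_simps)

lemma absorb_in_cube:
  assumes w: "0 \<le> w" and t: "0 \<le> t" "t \<le> w" and s: "s \<in> cube"
  shows "absorb w t s \<in> cube"
proof -
  have s': "\<bar>2 * s n - 1\<bar> \<le> 1" for n using s by (auto simp: abs_le_iff)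
  have c: "\<bar>carry w t s n\<bar> \<le> 1" for n
  proof (induction n)
    case 0
    have "0 \<le> t / w" "t / w \<le> 1" using w t by (auto simp: divide_le_eq_1)
    then show ?case by (auto simp: abs_le_iff)
  next
    case (Suc n)
    then show ?case
      using box_norm_square_rot[of "insert_angle w n" "Complex (carry w t s n) (2 * s n - 1)"] s'[of n]
      by (auto simp: box_norm_def)
  qed
  have "\<bar>2 * absorb w t s n - 1\<bar> \<le> 1" for n
    using box_norm_square_rot[of "insert_angle w n" "Complex (carry w t s n) (2 * s n - 1)"] s'[of n] c[of n]
    unfolding square_rot_carry by (auto simp: box_norm_def)
  then show ?thesis by (auto simp: abs_le_iff)
qed

text \<open>For \<open>w > 0\<close> the angles vanish from some \<open>N\<close> on, where the
  output is the carry itself; below \<open>N\<close> the steps are inverted one by one, down to the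
  start. For \<open>w = 0\<close> no such \<open>N\<close> exists, but \<open>t\<close> is forced to
  be 0 and only \<open>s\<close> has to be recovered.\<close>

lemma absorb_inj:
  assumes w: "0 \<le> w" and t: "0 \<le> t" "t \<le> w" "0 \<le> t'" "t' \<le> w"
    and eq: "absorb w t s = absorb w t' s'"
  shows "t = t' \<and> s = s'"
proof (cases "w = 0")
  case True
  then have "1 - s n = 1 - s' n" for n
    using absorb_small[of n w t s] absorb_small[of n w t' s'] eq by simp
  with t True show ?thesis by auto
next
  case False
  obtain N where N: "2 / w \<le> real N" using real_arch_simple by blast
  have large: "insert_angle w n = 0" if "N \<le> n" for n
  proof (rule insert_angle_large)
    have "2 \<le> real N * w" using N w False by (simp add: field_simps)
    also have "\<dots> \<le> real (Suc n) * w" using that w by (intro mult_right_mono) auto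
    finally show "2 \<le> real (Suc n) * w" .
  qed
  have rot: "Complex (carry w t s n) (2 * s n - 1) =
      square_rot (- insert_angle w n) (Complex (2 * absorb w t s n - 1) (carry w t s (Suc n)))" for t s n
    unfolding square_rot_carry[symmetric] square_rot_inverse ..
  have backward: "carry w t s n = carry w t' s' n \<and> s n = s' n"
    if "carry w t s (Suc n) = carry w t' s' (Suc n)" for n
  proof -
    have "Complex (carry w t s n) (2 * s n - 1) = Complex (carry w t' s' n) (2 * s' n - 1)"
      unfolding rot that eq ..
    then show ?thesis by simp
  qed
  have above: "carry w t s n = carry w t' s' n" if "N \<le> n" for n
  proof -
    have "carry w t s n = 2 * absorb w t s n - 1" for t s
      using square_rot_carry[of w n t s] large[OF that] by simp
    then show ?thesis by (simp add: eq)
  qed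
  have c: "carry w t s n = carry w t' s' n" for n
  proof (cases "n \<le> N")
    case True
    then show ?thesis
      by (induction rule: inc_induct) (use above backward in blast)+
  next
    case False
    then show ?thesis using above by simp
  qed
  have "s = s'" using backward c by blast
  moreover have "t = t'" using c[of 0] False by simp
  ultimately show ?thesis by auto
qed

lemma absorb_surj:
  assumes w: "0 \<le> w" and r: "r \<in> cube"
  obtains t s where "0 \<le> t" "t \<le> w" "s \<in> cube" "absorb w t s = r"
proof (cases "w = 0")
  case True
  have "absorb w 0 (\<lambda>n. 1 - r n) = r" using True by (auto simp: absorb_small)
  then show ?thesis using that[of 0 "\<lambda>n. 1 - r n"] True r by auto
next
  case False
  obtain N where N: "2 / w \<le> real N" using real_arch_simple by blast
  have large: "insert_angle w n = 0" if "N \<le> n" for n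
  proof (rule insert_angle_large)
    have "2 \<le> real N * w" using N w False by (simp add: field_simps)
    also have "\<dots> \<le> real (Suc n) * w" using that w by (intro mult_right_mono) auto
    finally show "2 \<le> real (Suc n) * w" .
  qed
  \<comment> \<open>\<open>C k\<close> is the carry that has to enter step \<open>N - k\<close>. At
    step \<open>N\<close> the carry equals the output; each earlier one is found by inverting a
    rotation.\<close>
  define C where "C = rec_nat (2 * r N - 1)
    (\<lambda>k x. Re (square_rot (- insert_angle w (N - Suc k)) (Complex (2 * r (N - Suc k) - 1) x)))"
  define c where "c n = (if N \<le> n then 2 * r n - 1 else C (N - n))" for n
  define z where "z n = square_rot (- insert_angle w n) (Complex (2 * r n - 1) (c (Suc n)))" for n
  define s where "s n = (1 + Im (z n)) / 2" for n
  define t where "t = w * ((1 + c 0) / 2)"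
  have r': "\<bar>2 * r n - 1\<bar> \<le> 1" for n using r by (auto simp: abs_le_iff)
  have Re_z: "Re (z n) = c n" for n
  proof (cases "N \<le> n")
    case True
    then show ?thesis by (simp add: z_def large c_def)
  next
    case False
    then obtain k where k: "N = Suc (n + k)" by (metis add_Suc_right less_iff_Suc_add not_le)
    have "c n = C (Suc k)" "c (Suc n) = C k"
      using False by (auto simp: c_def k C_def)
    then show ?thesis by (simp add: z_def C_def k)
  qed
  have rot: "square_rot (insert_angle w n) (z n) = Complex (2 * r n - 1) (c (Suc n))" for n
    unfolding z_def using square_rot_inverse[of "- insert_angle w n"] by simp
  have z: "z n = Complex (c n) (2 * s n - 1)" for n
    by (simp add: s_def complex_eq_iff Re_z field_simps)
  \<comment> \<open>The emitted coordinate lies in \<open>[-1,1]\<close> already, so by invariance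
    of the norm the bound on the carry travels downwards from \<open>N\<close>.\<close>
  have box_z: "box_norm (z n) \<le> 1 \<longleftrightarrow> \<bar>c (Suc n)\<bar> \<le> 1" for n
    using r'[of n] unfolding box_norm_square_rot[of "insert_angle w n" "z n", symmetric] rot
    by (simp add: box_norm_def)
  have c1: "\<bar>c n\<bar> \<le> 1" for n
  proof (cases "n \<le> N")
    case True
    then show ?thesis
    proof (induction rule: inc_induct)
      case base
      show ?case using r' by (simp add: c_def)
    next
      case (step n)
      then show ?case using box_z[of n] unfolding z by (simp add: box_norm_def)
    qed
  next
    case False
    then show ?thesis using r' by (simp add: c_def)
  qed
  then have s1: "\<bar>2 * s n - 1\<bar> \<le> 1" for n
    using box_z[of n] unfolding z by (simp add: box_norm_def)
  have carry: "carry w t s n = c n" for n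
  proof (induction n)
    case 0
    show ?case using False by (simp add: t_def field_simps)
  next
    case (Suc n)
    then show ?case using rot[of n] by (simp add: z)
  qed
  have "absorb w t s = r"
    using rot by (auto simp: absorb_def carry z)
  moreover have "s \<in> cube" using s1 by (auto simp: abs_le_iff)
  moreover have "0 \<le> (1 + c 0) / 2" "(1 + c 0) / 2 \<le> 1" using c1[of 0] by (auto simp: abs_le_iff)
  then have "0 \<le> t" "t \<le> w" using w unfolding t_def by (auto intro!: mult_nonneg_nonneg mult_left_le simp del: times_divide_eq_right)
  ultimately show ?thesis using that by blast
qed

text \<open>Two relatively open pieces cover the domain: on \<open>w > 0\<close> every ingredient is
  continuous, the division by \<open>w\<close> included, and where \<open>(n + 1) * w < 1\<close>
  the output is just \<open>1 - s n\<close>.\<close>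

lemma continuous_on_absorb:
  "continuous_on {(w, t, s). 0 \<le> t \<and> t \<le> w \<and> s \<in> cube} (\<lambda>(w, t, s). absorb w t s n)"
  (is "continuous_on ?D _")
proof -
  let ?P = "?D \<inter> {p. 0 < fst p}" and ?Z = "?D \<inter> {p. real (Suc n) * fst p < 1}"
  have eq: "?P \<union> ?Z = ?D"
  proof -
    have "0 < w" if "0 \<le> t" "t \<le> w" "\<not> real (Suc n) * w < 1" for t w :: real
      using that by (cases "w = 0") auto
    then show ?thesis by (auto simp del: of_nat_Suc)
  qed
  have coord: "continuous_on S (\<lambda>p. snd (snd p) k)" for S :: "(real \<times> real \<times> (nat \<Rightarrow> real)) set" and k
    by (rule continuous_on_compose2[OF continuous_on_product_coordinates[of k] continuous_on_snd[OF continuous_on_snd]])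
      (auto intro: continuous_on_id)
  have ang: "continuous_on S (\<lambda>p. insert_angle (fst p) k)" for S :: "(real \<times> real \<times> (nat \<Rightarrow> real)) set" and k
    unfolding insert_angle_def by (intro continuous_intros)
  have cplx: "continuous_on S (\<lambda>p. Complex (f p) (2 * snd (snd p) k - 1))" if "continuous_on S f"
    for S :: "(real \<times> real \<times> (nat \<Rightarrow> real)) set" and f k
    unfolding Complex_eq by (intro continuous_intros that coord)
  have "continuous_on ?P (\<lambda>p. carry (fst p) (fst (snd p)) (snd (snd p)) k)" for k
  proof (induction k)
    case 0
    show ?case unfolding carry.simps by (intro continuous_intros) auto
  next
    case (Suc k)
    then show ?case unfolding carry.simps
      by (intro continuous_intros continuous_on_square_rot ang cplx)
  qed
  then have P: "continuous_on ?P (\<lambda>p. absorb (fst p) (fst (snd p)) (snd (snd p)) n)"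
    unfolding absorb_def by (intro continuous_intros continuous_on_square_rot ang cplx) auto
  have "continuous_on ?Z (\<lambda>p. 1 - snd (snd p) n)"
    by (intro continuous_intros coord)
  then have Z: "continuous_on ?Z (\<lambda>p. absorb (fst p) (fst (snd p)) (snd (snd p)) n)"
    by (rule continuous_on_eq) (auto simp: absorb_small)
  have "open {p::real \<times> real \<times> (nat \<Rightarrow> real). 0 < fst p}"
       "open {p::real \<times> real \<times> (nat \<Rightarrow> real). real (Suc n) * fst p < 1}"
    by (intro open_Collect_less continuous_intros)+
  then have "openin (top_of_set (?P \<union> ?Z)) ?P" "openin (top_of_set (?P \<union> ?Z)) ?Z"
    unfolding eq by (auto intro: openin_open_Int)
  from continuous_on_Un_local_open[OF this P Z] show ?thesis
    unfolding eq by (simp add: case_prod_beta)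
qed

section \<open>Functionals and their extreme extensions\<close>

definition affine_fn :: "'a topology \<Rightarrow> real \<Rightarrow> real \<Rightarrow> ('a \<Rightarrow> real) \<Rightarrow> 'a \<Rightarrow> real" where
  "affine_fn Y a b f = (\<lambda>y\<in>topspace Y. a * f y + b)"

definition const_fn :: "'a topology \<Rightarrow> real \<Rightarrow> 'a \<Rightarrow> real" where
  "const_fn Y c = (\<lambda>y\<in>topspace Y. c)"

definition neg_fn :: "'a topology \<Rightarrow> ('a \<Rightarrow> real) \<Rightarrow> 'a \<Rightarrow> real" where
  "neg_fn Y f = (\<lambda>y\<in>topspace Y. - f y)"

abbreviation le_on :: "'a topology \<Rightarrow> ('a \<Rightarrow> real) \<Rightarrow> ('a \<Rightarrow> real) \<Rightarrow> bool" where
  "le_on Y f g \<equiv> (\<forall>y\<in>topspace Y. f y \<le> g y)"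

lemma CX_continuous: "f \<in> CX Y \<Longrightarrow> continuous_map Y euclideanreal f"
  by (simp add: CX_def)

lemma CX_eqI: "f \<in> CX Y \<Longrightarrow> g \<in> CX Y \<Longrightarrow> (\<And>y. y \<in> topspace Y \<Longrightarrow> f y = g y) \<Longrightarrow> f = g"
  by (auto simp: CX_def intro: extensionalityI)

lemma restrict_in_CX: "continuous_map Y euclideanreal f \<Longrightarrow> restrict f (topspace Y) \<in> CX Y"
  by (auto simp: CX_def intro: continuous_map_eq)

lemma affine_fn_CX: "f \<in> CX Y \<Longrightarrow> affine_fn Y a b f \<in> CX Y"
  unfolding affine_fn_def by (intro restrict_in_CX continuous_intros CX_continuous)

lemma const_fn_CX: "const_fn Y c \<in> CX Y"
  unfolding const_fn_def by (intro restrict_in_CX) simp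

lemma neg_fn_CX: "f \<in> CX Y \<Longrightarrow> neg_fn Y f \<in> CX Y"
  unfolding neg_fn_def by (intro restrict_in_CX continuous_intros CX_continuous)

lemma affine_fn_apply [simp]: "y \<in> topspace Y \<Longrightarrow> affine_fn Y a b f y = a * f y + b"
  by (simp add: affine_fn_def)

lemma const_fn_apply [simp]: "y \<in> topspace Y \<Longrightarrow> const_fn Y c y = c"
  by (simp add: const_fn_def)

lemma neg_fn_apply [simp]: "y \<in> topspace Y \<Longrightarrow> neg_fn Y f y = - f y"
  by (simp add: neg_fn_def)

lemma neg_fn_neg_fn [simp]: "f \<in> CX Y \<Longrightarrow> neg_fn Y (neg_fn Y f) = f"
  by (rule CX_eqI) (auto intro: neg_fn_CX)

lemma affine_fn_affine_fn: "affine_fn Y a b (affine_fn Y c d f) = affine_fn Y (a * c) (a * d + b) f"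
  by (auto simp: affine_fn_def algebra_simps)

lemma affine_fn_neg_fn: "affine_fn Y a b (neg_fn Y f) = neg_fn Y (affine_fn Y a (- b) f)"
  by (auto simp: affine_fn_def neg_fn_def)

lemma affine_fn_0: "affine_fn Y 0 b f = const_fn Y b"
  by (auto simp: affine_fn_def const_fn_def)

lemma affine_fn_id: "f \<in> CX Y \<Longrightarrow> affine_fn Y 1 0 f = f"
  by (rule CX_eqI) (auto intro: affine_fn_CX)

lemma CX_bounded:
  assumes "compact_space Y" "f \<in> CX Y"
  obtains C where "0 < C" "\<And>y. y \<in> topspace Y \<Longrightarrow> \<bar>f y\<bar> \<le> C"
proof -
  have "compactin euclideanreal (f ` topspace Y)"
    using assms by (metis CX_continuous compact_space_def image_compactin)
  then have "bounded (f ` topspace Y)" by (simp add: compact_imp_bounded)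
  then show ?thesis using that unfolding bounded_pos by auto
qed

lemma CX_attains_sup:
  assumes "compact_space Y" "topspace Y \<noteq> {}" "f \<in> CX Y"
  obtains p where "p \<in> topspace Y" "\<And>y. y \<in> topspace Y \<Longrightarrow> f y \<le> f p"
proof -
  have "compactin euclideanreal (f ` topspace Y)"
    using assms by (metis CX_continuous compact_space_def image_compactin)
  then show ?thesis
    using compact_attains_sup[of "f ` topspace Y"] assms(2) that by auto
qed

lemma CX_attains_inf:
  assumes "compact_space Y" "topspace Y \<noteq> {}" "f \<in> CX Y"
  obtains p where "p \<in> topspace Y" "\<And>y. y \<in> topspace Y \<Longrightarrow> f p \<le> f y"
  using CX_attains_sup[OF assms(1,2) neg_fn_CX[OF assms(3)]] by (metis neg_fn_apply neg_le_iff_le)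

section \<open>The space of functionals, its topology and its involution\<close>

lemma OH_set_iff:
  "M \<in> OH_set Y \<longleftrightarrow> M \<in> extensional (CX Y)
     \<and> (\<forall>f\<in>CX Y. \<forall>a\<ge>0. \<forall>b. M (affine_fn Y a b f) = a * M f + b)
     \<and> (\<forall>f\<in>CX Y. \<forall>g\<in>CX Y. le_on Y f g \<longrightarrow> M f \<le> M g)"
proof safe
  assume M: "M \<in> OH_set Y"
  show "M \<in> extensional (CX Y)" using M by (simp add: OH_set_def)
  show "M (affine_fn Y a b f) = a * M f + b" if "f \<in> CX Y" "0 \<le> a" for f a b
  proof -
    have 1: "M (affine_fn Y a 0 f) = a * M f"
      using M that by (auto simp: OH_set_def positively_homogeneous_def affine_fn_def)
    have "affine_fn Y a b f = (\<lambda>y\<in>topspace Y. affine_fn Y a 0 f y + b)"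
      by (auto simp: affine_fn_def)
    then show ?thesis
      using M affine_fn_CX[OF that(1), of a 0] 1 by (simp add: OH_set_def weakly_additive_def)
  qed
  show "M f \<le> M g" if "f \<in> CX Y" "g \<in> CX Y" "le_on Y f g" for f g
    using M that by (auto simp: OH_set_def order_preserving_def)
next
  assume ext: "M \<in> extensional (CX Y)"
    and aff: "\<forall>f\<in>CX Y. \<forall>a\<ge>0. \<forall>b. M (affine_fn Y a b f) = a * M f + b"
    and mono: "\<forall>f\<in>CX Y. \<forall>g\<in>CX Y. le_on Y f g \<longrightarrow> M f \<le> M g"
  \<comment> \<open>With \<open>a = 0\<close> the affine law evaluates constants; normedness is the
    case \<open>b = 1\<close>.\<close>
  have "normed Y M"
    unfolding normed_def using aff[rule_format, OF const_fn_CX[of Y 0], of 0 1]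
    by (simp add: affine_fn_0) (simp add: const_fn_def)
  moreover have "weakly_additive Y M"
    unfolding weakly_additive_def using aff[rule_format, of _ 1] by (simp add: affine_fn_def)
  moreover have "positively_homogeneous Y M"
    unfolding positively_homogeneous_def using aff[rule_format, of _ _ 0] by (simp add: affine_fn_def)
  ultimately show "M \<in> OH_set Y"
    using ext mono by (simp add: OH_set_def order_preserving_def)
qed

lemma OH_set_extensional: "M \<in> OH_set Y \<Longrightarrow> M \<in> extensional (CX Y)"
  by (simp add: OH_set_iff)

lemma OH_set_affine: "M \<in> OH_set Y \<Longrightarrow> f \<in> CX Y \<Longrightarrow> 0 \<le> a \<Longrightarrow> M (affine_fn Y a b f) = a * M f + b"
  by (simp add: OH_set_iff)

lemma OH_set_mono: "M \<in> OH_set Y \<Longrightarrow> f \<in> CX Y \<Longrightarrow> g \<in> CX Y \<Longrightarrow> le_on Y f g \<Longrightarrow> M f \<le> M g"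
  by (simp add: OH_set_iff)

lemma OH_set_const: "M \<in> OH_set Y \<Longrightarrow> M (const_fn Y c) = c"
  using OH_set_affine[of M Y "const_fn Y 0" 0 c] by (simp add: affine_fn_0 const_fn_CX)

lemma OH_set_le_const: "M \<in> OH_set Y \<Longrightarrow> f \<in> CX Y \<Longrightarrow> (\<And>y. y \<in> topspace Y \<Longrightarrow> f y \<le> c) \<Longrightarrow> M f \<le> c"
  using OH_set_mono[of M Y f "const_fn Y c"] by (simp add: OH_set_const const_fn_CX)

lemma OH_set_ge_const: "M \<in> OH_set Y \<Longrightarrow> f \<in> CX Y \<Longrightarrow> (\<And>y. y \<in> topspace Y \<Longrightarrow> c \<le> f y) \<Longrightarrow> c \<le> M f"
  using OH_set_mono[of M Y "const_fn Y c" f] by (simp add: OH_set_const const_fn_CX)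

lemma OH_set_le_add:
  assumes "M \<in> OH_set Y" "f \<in> CX Y" "g \<in> CX Y" "\<And>y. y \<in> topspace Y \<Longrightarrow> f y \<le> g y + e"
  shows "M f \<le> M g + e"
  using OH_set_mono[OF assms(1,2) affine_fn_CX[OF assms(3)], of 1 e] OH_set_affine[OF assms(1,3), of 1 e] assms(4)
  by simp

lemma OH_set_eqI:
  "M \<in> OH_set Y \<Longrightarrow> M' \<in> OH_set Y \<Longrightarrow> (\<And>f. f \<in> CX Y \<Longrightarrow> M f = M' f) \<Longrightarrow> M = M'"
  by (auto simp: OH_set_iff intro: extensionalityI)

text \<open>A functional lies between the infimum and the supremum of its argument, so the intervals
  in \<open>V Y\<close> exclude nothing. The axioms are closed conditions on at most two coordinates
  each; compactness is then Tychonoff's theorem.\<close>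

lemma OH_eq:
  assumes Y: "compact_space Y" "topspace Y \<noteq> {}"
  shows "OH Y = subtopology (product_topology (\<lambda>_. euclideanreal) (CX Y)) (OH_set Y)"
    and "topspace (OH Y) = OH_set Y"
    and "compact_space (OH Y)"
    and "Hausdorff_space (OH Y)"
proof -
  let ?I = "\<lambda>f. {(INF y\<in>topspace Y. f y)..(SUP y\<in>topspace Y. f y)}"
  let ?P = "product_topology (\<lambda>_. euclideanreal) (CX Y)"
  have V: "V Y = subtopology ?P (PiE (CX Y) ?I)"
    unfolding V_def by (simp add: subtopology_product_topology)
  have tV: "topspace (V Y) = PiE (CX Y) ?I"
    unfolding V_def by simp
  have sub: "OH_set Y \<subseteq> PiE (CX Y) ?I"
  proof
    fix M assume M: "M \<in> OH_set Y"
    have "M f \<in> ?I f" if f: "f \<in> CX Y" for f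
    proof -
      obtain C where "\<And>y. y \<in> topspace Y \<Longrightarrow> \<bar>f y\<bar> \<le> C" using CX_bounded[OF Y(1) f] by metis
      then have "bdd_above (f ` topspace Y)" "bdd_below (f ` topspace Y)"
        by (auto intro!: bdd_aboveI2[of _ _ C] bdd_belowI2[of _ "- C"] simp: abs_le_iff minus_le_iff)
      then show ?thesis
        using OH_set_le_const[OF M f] OH_set_ge_const[OF M f] cSUP_upper cINF_lower by fastforce
    qed
    then show "M \<in> PiE (CX Y) ?I" using OH_set_extensional[OF M] by (auto simp: PiE_def)
  qed
  show eq: "OH Y = subtopology ?P (OH_set Y)"
    unfolding OH_def V subtopology_subtopology using sub by (simp add: Int_absorb1)
  show top: "topspace (OH Y) = OH_set Y"
    using sub tV by (auto simp: OH_def)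
  have "compact_space (V Y)"
    unfolding V_def by (auto simp: compact_space_product_topology compact_space_subtopology)
  moreover have "closedin (V Y) (OH_set Y)"
  proof -
    have ev: "continuous_map (V Y) euclideanreal (\<lambda>M. M f)" if "f \<in> CX Y" for f
      unfolding V using that by (intro continuous_map_from_subtopology continuous_map_product_projection)
    have eq1: "OH_set Y = topspace (V Y)
        \<inter> (\<Inter>f\<in>CX Y. \<Inter>a\<in>{0..}. \<Inter>b. {M \<in> topspace (V Y). M (affine_fn Y a b f) = a * M f + b})
        \<inter> (\<Inter>f\<in>CX Y. \<Inter>g\<in>{g\<in>CX Y. le_on Y f g}. {M \<in> topspace (V Y). M f \<le> M g})"
      (is "_ = ?R")
    proof
      show "OH_set Y \<subseteq> ?R" using sub tV by (auto simp: OH_set_affine OH_set_mono)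
      show "?R \<subseteq> OH_set Y"
        using tV by (auto simp: OH_set_iff PiE_def)
    qed
    have "closedin (V Y) {M \<in> topspace (V Y). M f - a * M g \<in> S}" if "f \<in> CX Y" "g \<in> CX Y" "closed S" for f g a S
      by (rule closedin_continuous_map_preimage[of _ euclideanreal]) (use that in \<open>auto intro!: continuous_intros ev\<close>)
    from this[of _ _ "{_}"] this[of _ _ "{..0}" 1]
    have cl: "f \<in> CX Y \<Longrightarrow> g \<in> CX Y \<Longrightarrow> closedin (V Y) {M \<in> topspace (V Y). M f = a * M g + b}"
      "f \<in> CX Y \<Longrightarrow> g \<in> CX Y \<Longrightarrow> closedin (V Y) {M \<in> topspace (V Y). M f \<le> M g}" for f g a b
      by (simp_all add: algebra_simps)
    have ne: "CX Y \<noteq> {}" using const_fn_CX by blast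
    have ne': "{g \<in> CX Y. le_on Y f g} \<noteq> {}" if "f \<in> CX Y" for f
      using that by auto
    show ?thesis
      unfolding eq1
      by (intro closedin_Int closedin_topspace closedin_INT cl affine_fn_CX ne ne') auto
  qed
  ultimately show "compact_space (OH Y)"
    unfolding OH_def by (simp add: closedin_compact_space compact_space_subtopology)
  show "Hausdorff_space (OH Y)"
    unfolding eq by (intro Hausdorff_space_subtopology) (simp add: Hausdorff_space_product_topology)
qed

lemma continuous_map_OH_eval:
  "compact_space Y \<Longrightarrow> topspace Y \<noteq> {} \<Longrightarrow> f \<in> CX Y \<Longrightarrow> continuous_map (OH Y) euclideanreal (\<lambda>M. M f)"
  unfolding OH_eq(1) by (intro continuous_map_from_subtopology continuous_map_product_projection)

lemma continuous_map_into_OH: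
  assumes "compact_space Y" "topspace Y \<noteq> {}"
    and "\<And>z. z \<in> topspace Z \<Longrightarrow> F z \<in> OH_set Y"
    and "\<And>f. f \<in> CX Y \<Longrightarrow> continuous_map Z euclideanreal (\<lambda>z. F z f)"
  shows "continuous_map Z (OH Y) F"
  unfolding OH_eq(1)[OF assms(1,2)]
  using assms(3,4) OH_set_extensional
  by (auto simp: continuous_map_in_subtopology continuous_map_componentwise)

text \<open>An involution of \<open>OH Y\<close> that exchanges suprema over minorants with infima
  over majorants; upper bounds are thereby reduced to lower ones.\<close>

definition conj_fun :: "'a topology \<Rightarrow> (('a \<Rightarrow> real) \<Rightarrow> real) \<Rightarrow> ('a \<Rightarrow> real) \<Rightarrow> real" where
  "conj_fun Y M = (\<lambda>f\<in>CX Y. - M (neg_fn Y f))"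

lemma conj_fun_OH_set:
  assumes M: "M \<in> OH_set Y" shows "conj_fun Y M \<in> OH_set Y"
  unfolding OH_set_iff conj_fun_def
proof (intro conjI ballI allI impI)
  fix f and a b :: real assume f: "f \<in> CX Y" and "0 \<le> a"
  then have "M (neg_fn Y (affine_fn Y a b f)) = a * M (neg_fn Y f) - b"
    using OH_set_affine[OF M neg_fn_CX[OF f], of a "- b"] by (simp add: affine_fn_neg_fn)
  then show "(\<lambda>f\<in>CX Y. - M (neg_fn Y f)) (affine_fn Y a b f) = a * (\<lambda>f\<in>CX Y. - M (neg_fn Y f)) f + b"
    using f by (simp add: affine_fn_CX)
next
  fix f g assume "f \<in> CX Y" "g \<in> CX Y" "le_on Y f g"
  then show "(\<lambda>f\<in>CX Y. - M (neg_fn Y f)) f \<le> (\<lambda>f\<in>CX Y. - M (neg_fn Y f)) g"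
    using OH_set_mono[OF M neg_fn_CX neg_fn_CX, of g f] by simp
qed simp

lemma conj_fun_apply: "f \<in> CX Y \<Longrightarrow> conj_fun Y M f = - M (neg_fn Y f)"
  by (simp add: conj_fun_def)

lemma conj_fun_conj_fun: "M \<in> OH_set Y \<Longrightarrow> conj_fun Y (conj_fun Y M) = M"
  by (rule OH_set_eqI) (auto simp: conj_fun_OH_set conj_fun_apply neg_fn_CX)

lemma continuous_map_conj_fun:
  assumes Y: "compact_space Y" "topspace Y \<noteq> {}"
  shows "continuous_map (OH Y) (OH Y) (conj_fun Y)"
  by (rule continuous_map_into_OH[OF Y])
    (auto simp: OH_eq(2)[OF Y] conj_fun_OH_set conj_fun_apply neg_fn_CX
      intro: continuous_map_OH_eval[OF Y])

section \<open>Affine cones and the extreme extensions of a functional from them\<close>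

definition affine_cone :: "'a topology \<Rightarrow> ('a \<Rightarrow> real) set \<Rightarrow> bool" where
  "affine_cone Y A \<longleftrightarrow> A \<subseteq> CX Y \<and> A \<noteq> {} \<and> (\<forall>h\<in>A. \<forall>a\<ge>0. \<forall>b. affine_fn Y a b h \<in> A)"

lemma affine_cone_CX: "affine_cone Y A \<Longrightarrow> h \<in> A \<Longrightarrow> h \<in> CX Y"
  by (auto simp: affine_cone_def)

lemma affine_cone_affine: "affine_cone Y A \<Longrightarrow> h \<in> A \<Longrightarrow> 0 \<le> a \<Longrightarrow> affine_fn Y a b h \<in> A"
  by (auto simp: affine_cone_def)

lemma affine_cone_const: "affine_cone Y A \<Longrightarrow> const_fn Y c \<in> A"
  unfolding affine_cone_def by (metis affine_fn_0 all_not_in_conv order_refl)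

lemma affine_cone_neg: "affine_cone Y A \<Longrightarrow> affine_cone Y (neg_fn Y ` A)"
  by (auto simp: affine_cone_def neg_fn_CX affine_fn_neg_fn)

text \<open>For \<open>M\<close> in \<open>OH_set Y\<close> this is the least functional that agrees
  with \<open>M\<close> on the cone \<open>A\<close>. The supremum is over a nonempty set, because
  \<open>A\<close> contains the constants and \<open>f\<close> is bounded.\<close>

definition lower_ext ::
  "'a topology \<Rightarrow> ('a \<Rightarrow> real) set \<Rightarrow> (('a \<Rightarrow> real) \<Rightarrow> real) \<Rightarrow> ('a \<Rightarrow> real) \<Rightarrow> real" where
  "lower_ext Y A M = (\<lambda>f\<in>CX Y. Sup (M ` {h \<in> A. le_on Y h f}))"

text \<open>The infimum of \<open>M\<close> over the majorants of \<open>f\<close> in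
  \<open>A\<close>, written with the involution so that its properties are inherited from
  \<open>lower_ext\<close>.\<close>

definition upper_ext ::
  "'a topology \<Rightarrow> ('a \<Rightarrow> real) set \<Rightarrow> (('a \<Rightarrow> real) \<Rightarrow> real) \<Rightarrow> ('a \<Rightarrow> real) \<Rightarrow> real" where
  "upper_ext Y A M = conj_fun Y (lower_ext Y (neg_fn Y ` A) (conj_fun Y M))"

lemma lower_ext_ge:
  assumes "affine_cone Y A" "M \<in> OH_set Y" "f \<in> CX Y" "h \<in> A" "le_on Y h f"
  shows "M h \<le> lower_ext Y A M f"
proof -
  have "bdd_above (M ` {h \<in> A. le_on Y h f})"
    using OH_set_mono[OF assms(2) affine_cone_CX[OF assms(1)] assms(3)]
    by (intro bdd_aboveI2[of _ _ "M f"]) blast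
  then have "M h \<le> Sup (M ` {h \<in> A. le_on Y h f})"
    by (rule cSup_upper[rotated]) (rule imageI, simp add: assms)
  then show ?thesis
    using assms(3) by (simp add: lower_ext_def)
qed

lemma lower_ext_le:
  assumes "compact_space Y" "affine_cone Y A" "f \<in> CX Y"
    and "\<And>h. h \<in> A \<Longrightarrow> le_on Y h f \<Longrightarrow> M h \<le> c"
  shows "lower_ext Y A M f \<le> c"
proof -
  obtain C where "\<And>y. y \<in> topspace Y \<Longrightarrow> \<bar>f y\<bar> \<le> C" using CX_bounded[OF assms(1,3)] by metis
  then have "const_fn Y (- C) \<in> {h \<in> A. le_on Y h f}"
    using affine_cone_const[OF assms(2)] by (auto simp: abs_le_iff minus_le_iff)
  then have ne: "M ` {h \<in> A. le_on Y h f} \<noteq> {}" by blast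
  have "Sup (M ` {h \<in> A. le_on Y h f}) \<le> c"
    by (rule cSup_least[OF ne]) (use assms(4) in blast)
  then show ?thesis
    using assms(3) by (simp add: lower_ext_def)
qed

lemma lower_ext_cong: "(\<And>h. h \<in> A \<Longrightarrow> M h = M' h) \<Longrightarrow> lower_ext Y A M = lower_ext Y A M'"
  unfolding lower_ext_def by (intro restrict_ext arg_cong[where f = Sup] image_cong) auto

lemma lower_ext_le_self:
  assumes "compact_space Y" "affine_cone Y A" "M \<in> OH_set Y" "f \<in> CX Y"
  shows "lower_ext Y A M f \<le> M f"
  by (rule lower_ext_le[OF assms(1,2,4)])
    (rule OH_set_mono[OF assms(3) affine_cone_CX[OF assms(2)] assms(4)])

lemma lower_ext_eq:
  assumes "compact_space Y" "affine_cone Y A" "M \<in> OH_set Y" "h \<in> A"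
  shows "lower_ext Y A M h = M h"
  using lower_ext_le_self[OF assms(1-3)] lower_ext_ge[OF assms(2,3) _ assms(4)] affine_cone_CX[OF assms(2,4)] assms(4)
  by (simp add: order_antisym)

lemma lower_ext_OH_set:
  assumes Y: "compact_space Y" and A: "affine_cone Y A" and M: "M \<in> OH_set Y"
  shows "lower_ext Y A M \<in> OH_set Y"
  unfolding OH_set_iff
proof (intro conjI ballI allI impI)
  show "lower_ext Y A M \<in> extensional (CX Y)" by (simp add: lower_ext_def)
  have ge: "a * lower_ext Y A M f + b \<le> lower_ext Y A M (affine_fn Y a b f)"
    if f: "f \<in> CX Y" and a: "0 < a" for f and a b :: real
  proof -
    have "lower_ext Y A M f \<le> (lower_ext Y A M (affine_fn Y a b f) - b) / a"
    proof (rule lower_ext_le[OF Y A f])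
      fix h assume h: "h \<in> A" "le_on Y h f"
      have "a * M h + b = M (affine_fn Y a b h)"
        using OH_set_affine[OF M affine_cone_CX[OF A h(1)]] a by simp
      also have "\<dots> \<le> lower_ext Y A M (affine_fn Y a b f)"
        using h a by (intro lower_ext_ge[OF A M]) (auto intro: affine_fn_CX f affine_cone_affine[OF A])
      finally show "M h \<le> (lower_ext Y A M (affine_fn Y a b f) - b) / a"
        using a by (simp add: field_simps)
    qed
    then show ?thesis using a by (simp add: field_simps)
  qed
  fix f and a b :: real assume f: "f \<in> CX Y" and a: "0 \<le> a"
  show "lower_ext Y A M (affine_fn Y a b f) = a * lower_ext Y A M f + b"
  proof (cases "a = 0")
    case True
    then show ?thesis
      using lower_ext_eq[OF Y A M affine_cone_const[OF A]] by (simp add: affine_fn_0 OH_set_const[OF M])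
  next
    case False
    \<comment> \<open>The reverse inequality is \<open>ge\<close> for the inverse
      substitution.\<close>
    then have "affine_fn Y (1 / a) (- b / a) (affine_fn Y a b f) = f"
      using affine_fn_id[OF f] by (simp add: affine_fn_affine_fn)
    with False ge[of "affine_fn Y a b f" "1 / a" "- b / a"] affine_fn_CX[OF f, of a b]
    have "lower_ext Y A M (affine_fn Y a b f) \<le> a * lower_ext Y A M f + b"
      using a by (simp add: field_simps)
    with ge[of f a b] f a False show ?thesis by simp
  qed
next
  fix f g assume fg: "f \<in> CX Y" "g \<in> CX Y" "le_on Y f g"
  show "lower_ext Y A M f \<le> lower_ext Y A M g"
  proof (rule lower_ext_le[OF Y A fg(1)])
    fix h assume "h \<in> A" "le_on Y h f"
    then show "M h \<le> lower_ext Y A M g"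
      using fg by (intro lower_ext_ge[OF A M]) (auto intro: order_trans)
  qed
qed

lemma upper_ext_OH_set:
  assumes "compact_space Y" "affine_cone Y A" "M \<in> OH_set Y"
  shows "upper_ext Y A M \<in> OH_set Y"
  unfolding upper_ext_def by (intro conj_fun_OH_set lower_ext_OH_set affine_cone_neg assms)

lemma upper_ext_apply:
  "f \<in> CX Y \<Longrightarrow> upper_ext Y A M f = - lower_ext Y (neg_fn Y ` A) (conj_fun Y M) (neg_fn Y f)"
  by (simp add: upper_ext_def conj_fun_apply)

lemma upper_ext_ge_self:
  assumes "compact_space Y" "affine_cone Y A" "M \<in> OH_set Y" "f \<in> CX Y"
  shows "M f \<le> upper_ext Y A M f"
  using lower_ext_le_self[OF assms(1) affine_cone_neg[OF assms(2)] conj_fun_OH_set[OF assms(3)] neg_fn_CX[OF assms(4)]]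
  by (simp add: upper_ext_apply assms conj_fun_apply neg_fn_CX)

lemma upper_ext_eq:
  assumes "compact_space Y" "affine_cone Y A" "M \<in> OH_set Y" "h \<in> A"
  shows "upper_ext Y A M h = M h"
proof -
  have h: "h \<in> CX Y" using assms affine_cone_CX by blast
  show ?thesis
    using lower_ext_eq[OF assms(1) affine_cone_neg[OF assms(2)] conj_fun_OH_set[OF assms(3)], of "neg_fn Y h"] assms(4) h
    by (simp add: upper_ext_apply conj_fun_apply neg_fn_CX)
qed

lemma upper_ext_cong:
  assumes "affine_cone Y A" "\<And>h. h \<in> A \<Longrightarrow> M h = M' h"
  shows "upper_ext Y A M = upper_ext Y A M'"
  unfolding upper_ext_def using assms affine_cone_CX[OF assms(1)]
  by (intro arg_cong[where f = "conj_fun Y"] lower_ext_cong) (auto simp: conj_fun_apply neg_fn_CX)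

lemma upper_ext_ge:
  assumes "compact_space Y" "affine_cone Y A" "f \<in> CX Y"
    and "\<And>h. h \<in> A \<Longrightarrow> le_on Y f h \<Longrightarrow> c \<le> M h"
  shows "c \<le> upper_ext Y A M f"
proof -
  have "lower_ext Y (neg_fn Y ` A) (conj_fun Y M) (neg_fn Y f) \<le> - c"
    using assms(4) affine_cone_CX[OF assms(2)]
    by (intro lower_ext_le[OF assms(1) affine_cone_neg[OF assms(2)] neg_fn_CX[OF assms(3)]])
      (auto simp: conj_fun_apply neg_fn_CX)
  then show ?thesis by (simp add: upper_ext_apply assms(3))
qed

definition mix :: "'a topology \<Rightarrow> real \<Rightarrow> (('a \<Rightarrow> real) \<Rightarrow> real) \<Rightarrow> (('a \<Rightarrow> real) \<Rightarrow> real) \<Rightarrow> ('a \<Rightarrow> real) \<Rightarrow> real" where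
  "mix Y t M N = (\<lambda>f\<in>CX Y. (1 - t) * M f + t * N f)"

lemma mix_OH_set:
  assumes "M \<in> OH_set Y" "N \<in> OH_set Y" "0 \<le> t" "t \<le> 1"
  shows "mix Y t M N \<in> OH_set Y"
  unfolding OH_set_iff
proof (intro conjI ballI allI impI)
  fix f and a b :: real assume "f \<in> CX Y" "0 \<le> a"
  then show "mix Y t M N (affine_fn Y a b f) = a * mix Y t M N f + b"
    by (simp add: mix_def affine_fn_CX OH_set_affine[OF assms(1)] OH_set_affine[OF assms(2)] algebra_simps)
next
  fix f g assume "f \<in> CX Y" "g \<in> CX Y" "le_on Y f g"
  then show "mix Y t M N f \<le> mix Y t M N g"
    using assms(3,4) OH_set_mono[OF assms(1), of f g] OH_set_mono[OF assms(2), of f g]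
    by (simp add: mix_def add_mono mult_left_mono)
qed (simp add: mix_def)

text \<open>Both extreme extensions coincide with \<open>M\<close> on \<open>A\<close>, hence so
  does every convex combination of them, and its value at \<open>f\<close> runs through the whole
  interval.\<close>

lemma extend_with_value:
  assumes "compact_space Y" "affine_cone Y A" "M \<in> OH_set Y" "f \<in> CX Y"
    and v: "lower_ext Y A M f \<le> v" "v \<le> upper_ext Y A M f"
  obtains M' where "M' \<in> OH_set Y" "\<And>h. h \<in> A \<Longrightarrow> M' h = M h" "M' f = v"
proof -
  obtain t where t: "0 \<le> t" "t \<le> 1" "(1 - t) * lower_ext Y A M f + t * upper_ext Y A M f = v"
  proof -
    have "v \<in> closed_segment (lower_ext Y A M f) (upper_ext Y A M f)"
      using v by (simp add: closed_segment_eq_real_ivl)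
    then show thesis using that by (auto simp: in_segment)
  qed
  show ?thesis
  proof (rule that)
    show "mix Y t (lower_ext Y A M) (upper_ext Y A M) \<in> OH_set Y"
      using t assms by (intro mix_OH_set lower_ext_OH_set upper_ext_OH_set)
    show "mix Y t (lower_ext Y A M) (upper_ext Y A M) h = M h" if "h \<in> A" for h
      using that assms by (simp add: mix_def affine_cone_CX lower_ext_eq upper_ext_eq algebra_simps)
    show "mix Y t (lower_ext Y A M) (upper_ext Y A M) f = v"
      using t assms by (simp add: mix_def)
  qed
qed

section \<open>Finite domination and continuity of the extreme extensions\<close>

lemma dickson:
  fixes n :: "'p \<Rightarrow> 'j \<Rightarrow> nat"
  assumes "finite J"
  shows "\<exists>B. finite B \<and> B \<subseteq> P \<and> (\<forall>p\<in>P. \<exists>q\<in>B. \<forall>j\<in>J. n q j \<le> n p j)"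
  using assms
proof (induction J arbitrary: P rule: finite_psubset_induct)
  case (psubset J)
  show ?case
  proof (cases "P = {}")
    case False
    then obtain p0 where p0: "p0 \<in> P" by blast
    define Q where "Q j v B \<longleftrightarrow> finite B \<and> B \<subseteq> {p \<in> P. n p j = v} \<and>
        (\<forall>p\<in>{p \<in> P. n p j = v}. \<exists>q\<in>B. \<forall>i\<in>J - {j}. n q i \<le> n p i)" for j v B
    define B where "B j v = (SOME B. Q j v B)" for j v
    have B: "Q j v (B j v)" if "j \<in> J" for j v
    proof -
      have "\<exists>B. Q j v B"
        unfolding Q_def by (rule psubset.IH[of "J - {j}" "{p \<in> P. n p j = v}"]) (use that in auto)
      then show ?thesis unfolding B_def by (rule someI_ex)
    qed
    let ?B = "insert p0 (\<Union>j\<in>J. \<Union>v\<in>{..<n p0 j}. B j v)"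
    have "\<exists>q\<in>?B. \<forall>j\<in>J. n q j \<le> n p j" if p: "p \<in> P" for p
    proof (cases "\<forall>j\<in>J. n p0 j \<le> n p j")
      case False
      then obtain j where j: "j \<in> J" "n p j < n p0 j" by (meson not_le)
      have "p \<in> {r \<in> P. n r j = n p j}" using p by simp
      then obtain q where q: "q \<in> B j (n p j)" "\<forall>i\<in>J - {j}. n q i \<le> n p i"
        using B[OF j(1), of "n p j", unfolded Q_def] by blast
      moreover have "n q j = n p j" using B[OF j(1), of "n p j", unfolded Q_def] q(1) by blast
      ultimately have "\<forall>i\<in>J. n q i \<le> n p i" by (metis DiffI insertE empty_iff order_refl)
      moreover have "q \<in> ?B" using q(1) j by blast
      ultimately show ?thesis by blast
    qed auto
    moreover have "finite ?B" using psubset.hyps B by (auto simp: Q_def)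
    moreover have "?B \<subseteq> P"
    proof -
      have "B j v \<subseteq> P" if "j \<in> J" for j v using B[OF that, of v] by (auto simp: Q_def)
      then show ?thesis using p0 by auto
    qed
    ultimately show ?thesis by blast
  qed auto
qed

text \<open>Rounding \<open>(C - c p j) / e\<close> turns large reals into small naturals. Only an
  upper bound is assumed, so the values need not lie in a bounded box that could be covered by
  finitely many small cubes.\<close>

lemma dickson_real:
  fixes c :: "'p \<Rightarrow> 'j \<Rightarrow> real"
  assumes J: "finite J" and C: "\<And>p j. p \<in> P \<Longrightarrow> j \<in> J \<Longrightarrow> c p j \<le> C" and e: "0 < e"
  shows "\<exists>B. finite B \<and> B \<subseteq> P \<and> (\<forall>p\<in>P. \<exists>q\<in>B. \<forall>j\<in>J. c p j \<le> c q j + e)"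
proof -
  let ?n = "\<lambda>p j. nat \<lfloor>(C - c p j) / e\<rfloor>"
  obtain B where B: "finite B" "B \<subseteq> P" "\<forall>p\<in>P. \<exists>q\<in>B. \<forall>j\<in>J. ?n q j \<le> ?n p j"
    using dickson[OF J, of P ?n] by (elim exE conjE)
  have "c p j \<le> c q j + e" if "p \<in> P" "q \<in> P" "j \<in> J" "?n q j \<le> ?n p j" for p q j
  proof -
    have "0 \<le> (C - c p j) / e" "0 \<le> (C - c q j) / e" using C[OF that(1,3)] C[OF that(2,3)] e by auto
    then have "(C - c q j) / e < (C - c p j) / e + 1" using that(4) by linarith
    then have "(C - c q j) / e * e \<le> ((C - c p j) / e + 1) * e" using e by (intro mult_right_mono) auto
    then show ?thesis using e by (simp add: distrib_right)
  qed
  note le = this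
  show ?thesis
  proof (intro exI[of _ B] conjI ballI B)
    fix p assume p: "p \<in> P"
    then obtain q where "q \<in> B" "\<forall>j\<in>J. ?n q j \<le> ?n p j" using B(3) by blast
    then show "\<exists>q\<in>B. \<forall>j\<in>J. c p j \<le> c q j + e" using le[OF p, of q] B(2) by blast
  qed
qed

text \<open>A substitute for compactness of the minorants of \<open>f\<close> in \<open>A\<close>, which need not be bounded below.\<close>
definition finitely_dominated :: "'a topology \<Rightarrow> ('a \<Rightarrow> real) set \<Rightarrow> ('a \<Rightarrow> real) \<Rightarrow> bool" where
  "finitely_dominated Y A f \<longleftrightarrow> (\<forall>e>0. \<exists>B. finite B \<and> B \<subseteq> {h \<in> A. le_on Y h f} \<and>
     (\<forall>h\<in>A. le_on Y h f \<longrightarrow> (\<exists>k\<in>B. \<forall>y\<in>topspace Y. h y \<le> k y + e)))"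

lemma finitely_dominated_Un:
  assumes "finitely_dominated Y A f" "finitely_dominated Y B f"
  shows "finitely_dominated Y (A \<union> B) f"
  unfolding finitely_dominated_def
proof (intro allI impI)
  fix e :: real assume e: "0 < e"
  obtain A' where "finite A'" "A' \<subseteq> {h \<in> A. le_on Y h f}"
    "\<forall>h\<in>A. le_on Y h f \<longrightarrow> (\<exists>k\<in>A'. \<forall>y\<in>topspace Y. h y \<le> k y + e)"
    using assms(1)[unfolded finitely_dominated_def, THEN spec, THEN mp, OF e] by (elim exE conjE)
  moreover obtain B' where "finite B'" "B' \<subseteq> {h \<in> B. le_on Y h f}"
    "\<forall>h\<in>B. le_on Y h f \<longrightarrow> (\<exists>k\<in>B'. \<forall>y\<in>topspace Y. h y \<le> k y + e)"
    using assms(2)[unfolded finitely_dominated_def, THEN spec, THEN mp, OF e] by (elim exE conjE)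
  ultimately show "\<exists>B'. finite B' \<and> B' \<subseteq> {h \<in> A \<union> B. le_on Y h f} \<and>
     (\<forall>h\<in>A \<union> B. le_on Y h f \<longrightarrow> (\<exists>k\<in>B'. \<forall>y\<in>topspace Y. h y \<le> k y + e))"
    by (intro exI[of _ "A' \<union> B'"]) blast
qed

text \<open>A supremum of continuous evaluations is lower semicontinuous. The other half needs the
  finite set \<open>B\<close>: closeness to \<open>M\<close> on \<open>B\<close> is an open
  condition, and it controls all minorants up to \<open>e\<close>.\<close>

lemma continuous_map_lower_ext:
  assumes Y: "compact_space Y" "topspace Y \<noteq> {}" and A: "affine_cone Y A" and f: "f \<in> CX Y"
    and dom: "finitely_dominated Y A f"
  shows "continuous_map (OH Y) euclideanreal (\<lambda>M. lower_ext Y A M f)"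
  unfolding continuous_map_upper_lower_semicontinuous_lt
proof (intro conjI allI)
  fix a
  have ev: "continuous_map (OH Y) euclideanreal (\<lambda>M. M h)" if "h \<in> A" for h
    using that A by (intro continuous_map_OH_eval[OF Y] affine_cone_CX)
  show "openin (OH Y) {M \<in> topspace (OH Y). a < lower_ext Y A M f}"
  proof (subst openin_subopen, intro ballI)
    fix M assume "M \<in> {M \<in> topspace (OH Y). a < lower_ext Y A M f}"
    then have M: "M \<in> OH_set Y" "a < lower_ext Y A M f" by (auto simp: OH_eq(2)[OF Y])
    then have "\<not> (\<forall>h\<in>A. le_on Y h f \<longrightarrow> M h \<le> a)"
      using lower_ext_le[OF Y(1) A f, of M a] by force
    then obtain h where h: "h \<in> A" "le_on Y h f" "a < M h" by (auto simp: not_le)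
    have "openin (OH Y) {M \<in> topspace (OH Y). M h \<in> {a<..}}"
      by (rule openin_continuous_map_preimage[OF ev[OF h(1)]]) auto
    moreover have "{M \<in> topspace (OH Y). M h \<in> {a<..}} \<subseteq> {M \<in> topspace (OH Y). a < lower_ext Y A M f}"
      using lower_ext_ge[OF A _ f h(1,2)] by (auto simp: OH_eq(2)[OF Y] intro: less_le_trans)
    ultimately show "\<exists>T. openin (OH Y) T \<and> M \<in> T \<and> T \<subseteq> {M \<in> topspace (OH Y). a < lower_ext Y A M f}"
      using h M by (intro exI[of _ "{M \<in> topspace (OH Y). M h \<in> {a<..}}"]) (auto simp: OH_eq(2)[OF Y])
  qed
  show "openin (OH Y) {M \<in> topspace (OH Y). lower_ext Y A M f < a}"
  proof (subst openin_subopen, intro ballI)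
    fix M assume "M \<in> {M \<in> topspace (OH Y). lower_ext Y A M f < a}"
    then have M: "M \<in> OH_set Y" "lower_ext Y A M f < a" by (auto simp: OH_eq(2)[OF Y])
    \<comment> \<open>Half of the gap: domination costs \<open>e\<close>, the neighbourhood of
      \<open>M\<close> costs \<open>e / 2\<close>, and the total stays below
      \<open>2 * e\<close>.\<close>
    define e where "e = (a - lower_ext Y A M f) / 2"
    have "0 < e" using M by (simp add: e_def)
    obtain B where B: "finite B" "B \<subseteq> {h \<in> A. le_on Y h f}"
      "\<forall>h\<in>A. le_on Y h f \<longrightarrow> (\<exists>k\<in>B. \<forall>y\<in>topspace Y. h y \<le> k y + e)"
      using dom[unfolded finitely_dominated_def, THEN spec, THEN mp, OF \<open>0 < e\<close>] by (elim exE conjE)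
    let ?T = "(\<Inter>k\<in>B. {N \<in> topspace (OH Y). N k \<in> {..<M k + e / 2}}) \<inter> topspace (OH Y)"
    have "openin (OH Y) ?T"
    proof (rule openin_INT[OF B(1)])
      fix k assume "k \<in> B"
      then have "k \<in> A" using B(2) by blast
      then show "openin (OH Y) {N \<in> topspace (OH Y). N k \<in> {..<M k + e / 2}}"
        by (rule openin_continuous_map_preimage[OF ev]) simp
    qed
    moreover have "M \<in> ?T" using M \<open>0 < e\<close> by (auto simp: OH_eq(2)[OF Y])
    moreover have "lower_ext Y A N f < a" if N: "N \<in> ?T" for N
    proof -
      have NO: "N \<in> OH_set Y" using N by (simp add: OH_eq(2)[OF Y])
      have "lower_ext Y A N f \<le> lower_ext Y A M f + e / 2 + e"
      proof (rule lower_ext_le[OF Y(1) A f])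
        fix h assume h: "h \<in> A" "le_on Y h f"
        then obtain k where k: "k \<in> B" "\<forall>y\<in>topspace Y. h y \<le> k y + e" using B by blast
        have "N h \<le> N k + e"
          using k(2) k(1) B(2) by (intro OH_set_le_add[OF NO] affine_cone_CX[OF A] h) auto
        moreover have "N k < M k + e / 2" using N k by auto
        moreover have "M k \<le> lower_ext Y A M f" using k B M by (intro lower_ext_ge[OF A _ f]) auto
        ultimately show "N h \<le> lower_ext Y A M f + e / 2 + e" by linarith
      qed
      also have "\<dots> < a" using \<open>0 < e\<close> unfolding e_def by (simp add: field_simps)
      finally show ?thesis .
    qed
    ultimately show "\<exists>T. openin (OH Y) T \<and> M \<in> T \<and> T \<subseteq> {M \<in> topspace (OH Y). lower_ext Y A M f < a}"
      by (intro exI[of _ ?T]) auto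
  qed
qed

lemma continuous_map_upper_ext:
  assumes Y: "compact_space Y" "topspace Y \<noteq> {}" and A: "affine_cone Y A" and f: "f \<in> CX Y"
    and dom: "finitely_dominated Y (neg_fn Y ` A) (neg_fn Y f)"
  shows "continuous_map (OH Y) euclideanreal (\<lambda>M. upper_ext Y A M f)"
proof -
  note continuous_map_compose[OF continuous_map_conj_fun[OF Y]
      continuous_map_lower_ext[OF Y affine_cone_neg[OF A] neg_fn_CX[OF f] dom]]
  then show ?thesis
    unfolding upper_ext_apply[OF f] o_def by (rule continuous_map_minus)
qed

definition affine_ray :: "'a topology \<Rightarrow> ('a \<Rightarrow> real) \<Rightarrow> ('a \<Rightarrow> real) set" where
  "affine_ray Y d = {affine_fn Y a b d | a b. 0 \<le> a}"

lemma affine_cone_ray: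
  assumes d: "d \<in> CX Y" shows "affine_cone Y (affine_ray Y d)"
  unfolding affine_cone_def
proof (intro conjI ballI allI impI)
  show "affine_ray Y d \<subseteq> CX Y" using affine_fn_CX[OF d] by (auto simp: affine_ray_def)
  show "affine_ray Y d \<noteq> {}" by (auto simp: affine_ray_def)
  fix h and a b :: real assume "h \<in> affine_ray Y d" "0 \<le> a"
  then obtain a' b' where "h = affine_fn Y a' b' d" "0 \<le> a * a'" by (auto simp: affine_ray_def)
  then show "affine_fn Y a b h \<in> affine_ray Y d" unfolding affine_ray_def by (auto simp: affine_fn_affine_fn)
qed

lemma mem_affine_ray: "d \<in> CX Y \<Longrightarrow> d \<in> affine_ray Y d"
  unfolding affine_ray_def by (rule CollectI, rule exI[of _ 1], rule exI[of _ 0]) (simp add: affine_fn_id)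

lemma neg_affine_ray: "neg_fn Y ` affine_ray Y d = affine_ray Y (neg_fn Y d)"
proof
  show "neg_fn Y ` affine_ray Y d \<subseteq> affine_ray Y (neg_fn Y d)"
  proof safe
    fix h assume "h \<in> affine_ray Y d"
    then obtain a b where "h = affine_fn Y a b d" "0 \<le> a" by (auto simp: affine_ray_def)
    then have "neg_fn Y h = affine_fn Y a (- b) (neg_fn Y d)" "0 \<le> a" by (simp_all add: affine_fn_neg_fn)
    then show "neg_fn Y h \<in> affine_ray Y (neg_fn Y d)" unfolding affine_ray_def by blast
  qed
  show "affine_ray Y (neg_fn Y d) \<subseteq> neg_fn Y ` affine_ray Y d"
    unfolding affine_ray_def by (auto simp: affine_fn_neg_fn)
qed

lemma affine_ray_cong:
  assumes "M \<in> OH_set Y" "M' \<in> OH_set Y" "d \<in> CX Y" "M d = M' d" "h \<in> affine_ray Y d"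
  shows "M h = M' h"
  using assms by (auto simp: affine_ray_def OH_set_affine)

text \<open>The difference of two members of the ray is an affine function of the value of
  \<open>d\<close>, so it is largest at a maximum or a minimum point of \<open>d\<close>. Two test
  points therefore suffice, and \<open>dickson_real\<close> applies to the values there.\<close>

lemma finitely_dominated_ray:
  assumes Y: "compact_space Y" "topspace Y \<noteq> {}" and f: "f \<in> CX Y" and d: "d \<in> CX Y"
  shows "finitely_dominated Y (affine_ray Y d) f"
  unfolding finitely_dominated_def
proof (intro allI impI)
  fix e :: real assume e: "0 < e"
  obtain p where p: "p \<in> topspace Y" "\<And>y. y \<in> topspace Y \<Longrightarrow> d y \<le> d p"
    by (rule CX_attains_sup[OF Y d]) blast
  obtain q where q: "q \<in> topspace Y" "\<And>y. y \<in> topspace Y \<Longrightarrow> d q \<le> d y"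
    by (rule CX_attains_inf[OF Y d]) blast
  obtain C where C: "\<And>y. y \<in> topspace Y \<Longrightarrow> \<bar>f y\<bar> \<le> C" by (rule CX_bounded[OF Y(1) f]) blast
  let ?P = "{h \<in> affine_ray Y d. le_on Y h f}"
  have bound: "h y \<le> C" if "h \<in> ?P" "y \<in> {p, q}" for h y
    using that p(1) q(1) C[of y] order_trans[of "h y" "f y" C] by (auto simp: abs_le_iff)
  have "\<exists>B. finite B \<and> B \<subseteq> ?P \<and> (\<forall>h\<in>?P. \<exists>k\<in>B. \<forall>y\<in>{p, q}. h y \<le> k y + e)"
    using bound e by (intro dickson_real[where c = "\<lambda>h. h" and C = C]) simp
  then obtain B where B: "finite B" "B \<subseteq> ?P" "\<forall>h\<in>?P. \<exists>k\<in>B. \<forall>y\<in>{p, q}. h y \<le> k y + e"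
    by (elim exE conjE)
  have "\<forall>y\<in>topspace Y. h y \<le> k y + e"
    if hk: "h \<in> affine_ray Y d" "k \<in> affine_ray Y d" "h p \<le> k p + e" "h q \<le> k q + e" for h k
  proof
    fix y assume y: "y \<in> topspace Y"
    obtain a b a' b' where ab: "h = affine_fn Y a b d" "k = affine_fn Y a' b' d" "0 \<le> a" "0 \<le> a'"
      using hk(1,2) unfolding affine_ray_def by blast
    have 1: "(a - a') * d p \<le> b' - b + e" "(a - a') * d q \<le> b' - b + e"
      using hk(3,4) p(1) q(1) unfolding ab(1,2) by (auto simp: algebra_simps)
    have "(a - a') * d y \<le> b' - b + e"
    proof (cases "a \<le> a'")
      case True
      then show ?thesis using 1(2) mult_left_mono_neg[OF q(2)[OF y], of "a - a'"] by simp
    next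
      case False
      then show ?thesis using 1(1) mult_left_mono[OF p(2)[OF y], of "a - a'"] by linarith
    qed
    then show "h y \<le> k y + e" using y unfolding ab(1,2) by (simp add: left_diff_distrib)
  qed
  note dominates = this
  have "\<exists>k\<in>B. \<forall>y\<in>topspace Y. h y \<le> k y + e" if h: "h \<in> affine_ray Y d" "le_on Y h f" for h
  proof -
    have "h \<in> ?P" using h by simp
    from bspec[OF B(3) this] obtain k where "k \<in> B" "\<forall>y\<in>{p, q}. h y \<le> k y + e" by (rule bexE)
    then have k: "k \<in> B" "h p \<le> k p + e" "h q \<le> k q + e" by simp_all
    moreover have "k \<in> affine_ray Y d" using k B(2) by blast
    ultimately show ?thesis by (intro bexI[of _ k] dominates[OF h(1)])
  qed
  with B(1,2) show "\<exists>B. finite B \<and> B \<subseteq> ?P \<and>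
     (\<forall>h\<in>affine_ray Y d. le_on Y h f \<longrightarrow> (\<exists>k\<in>B. \<forall>y\<in>topspace Y. h y \<le> k y + e))"
    by (intro exI[of _ B] conjI ballI impI)
qed

section \<open>Separating families and partitions of unity\<close>

definition separating :: "'a topology \<Rightarrow> ('a \<Rightarrow> real) set \<Rightarrow> bool" where
  "separating X D \<longleftrightarrow> D \<subseteq> CX X \<and>
     (\<forall>x\<in>topspace X. \<forall>y\<in>topspace X. x \<noteq> y \<longrightarrow> (\<exists>g\<in>D. g x \<noteq> g y))"

lemma compact_space_subcover:
  assumes "compact_space X" "\<And>i. i \<in> I \<Longrightarrow> openin X (U i)" "topspace X \<subseteq> (\<Union>i\<in>I. U i)"
  obtains I' where "finite I'" "I' \<subseteq> I" "topspace X \<subseteq> (\<Union>i\<in>I'. U i)"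
proof -
  have "\<exists>\<F>. finite \<F> \<and> \<F> \<subseteq> U ` I \<and> topspace X \<subseteq> \<Union>\<F>"
    using assms(1)[unfolded compact_space_alt, THEN spec, of "U ` I"] assms(2,3) by simp
  then obtain \<F> where F: "finite \<F>" "\<F> \<subseteq> U ` I" "topspace X \<subseteq> \<Union>\<F>" by (elim exE conjE)
  obtain I' where "I' \<subseteq> I" "finite I'" "\<F> = U ` I'" using finite_subset_image[OF F(1,2)] by (elim exE conjE)
  with F(3) that show thesis by simp
qed

text \<open>Uniform continuity with respect to \<open>D\<close>, from compactness of the square of
  \<open>X\<close>: the pairs where \<open>f\<close> varies by less than \<open>e\<close> form an
  open set containing the diagonal, and off the diagonal some \<open>g\<close> separates.\<close>

lemma separating_uniform:
  assumes X: "compact_space X" and D: "separating X D" and f: "f \<in> CX X" and e: "0 < e"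
  obtains G \<delta> where "finite G" "G \<subseteq> D" "0 < \<delta>"
    "\<And>x y. \<lbrakk>x \<in> topspace X; y \<in> topspace X; \<forall>g\<in>G. \<bar>g x - g y\<bar> < \<delta>\<rbrakk> \<Longrightarrow> \<bar>f x - f y\<bar> < e"
proof -
  let ?P = "prod_topology X X"
  define diff where "diff g p = \<bar>g (fst p) - g (snd p)\<bar>" for g :: "'a \<Rightarrow> real" and p
  have cont: "continuous_map ?P euclideanreal (diff g)" if "g \<in> CX X" for g
    unfolding diff_def using that
    by (intro continuous_intros continuous_map_compose[OF continuous_map_fst, unfolded o_def]
        continuous_map_compose[OF continuous_map_snd, unfolded o_def] CX_continuous)
  define far where "far g \<delta> = {p \<in> topspace ?P. diff g p \<in> {\<delta><..}}" for g :: "'a \<Rightarrow> real" and \<delta>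
  define close where "close = {p \<in> topspace ?P. diff f p \<in> {..<e}}"
  \<comment> \<open>\<open>None\<close> is the index of the neighbourhood of the diagonal,
    \<open>Some (g, \<delta>)\<close> that of the set where \<open>g\<close> varies by more than
    \<open>\<delta>\<close>.\<close>
  define U where "U = case_option close (\<lambda>(g, \<delta>). far g \<delta>)"
  let ?I = "insert None (Some ` (D \<times> {0<..}))"
  have D': "D \<subseteq> CX X" using D by (simp add: separating_def)
  have "openin ?P close" unfolding close_def
    by (rule openin_continuous_map_preimage[OF cont[OF f]]) simp
  moreover have "openin ?P (far g \<delta>)" if "g \<in> D" for g \<delta>
    unfolding far_def by (rule openin_continuous_map_preimage[OF cont]) (use that D' in auto)
  ultimately have U: "openin ?P (U i)" if "i \<in> ?I" for i
    using that by (auto simp: U_def)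
  have cover: "topspace ?P \<subseteq> (\<Union>i\<in>?I. U i)"
  proof
    fix p assume p: "p \<in> topspace ?P"
    show "p \<in> (\<Union>i\<in>?I. U i)"
    proof (cases "fst p = snd p")
      case True
      then have "p \<in> U None" using p e by (simp add: U_def close_def diff_def)
      then show ?thesis by blast
    next
      case False
      have "fst p \<in> topspace X" "snd p \<in> topspace X" using p by auto
      with False obtain g where g: "g \<in> D" "g (fst p) \<noteq> g (snd p)"
        using D unfolding separating_def by blast
      then have "p \<in> U (Some (g, diff g p / 2))" "(g, diff g p / 2) \<in> D \<times> {0<..}"
        using p by (auto simp: U_def far_def diff_def)
      then show ?thesis by blast
    qed
  qed
  have "compact_space ?P" using X by (simp add: compact_space_prod_topology)
  then obtain I' where I': "finite I'" "I' \<subseteq> ?I" "topspace ?P \<subseteq> (\<Union>i\<in>I'. U i)"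
    using compact_space_subcover[OF _ U cover] by metis
  define I where "I = Some -` I'"
  have I: "finite I" "I \<subseteq> D \<times> {0<..}"
    using I'(1,2) by (auto simp: I_def intro: finite_vimageI)
  \<comment> \<open>The inserted 1 covers the case that the subcover uses no separating
    function.\<close>
  define \<delta> where "\<delta> = Min (insert 1 (snd ` I))"
  have \<delta>: "0 < \<delta>" "\<And>i. i \<in> I \<Longrightarrow> \<delta> \<le> snd i"
    using I by (auto simp: \<delta>_def)
  have near: "\<bar>f x - f y\<bar> < e"
    if xy: "x \<in> topspace X" "y \<in> topspace X" and g: "\<forall>g\<in>fst ` I. \<bar>g x - g y\<bar> < \<delta>" for x y
  proof -
    obtain i where i: "i \<in> I'" "(x, y) \<in> U i" using xy I'(3) by auto
    have "i = None"
    proof (rule ccontr)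
      assume "i \<noteq> None"
      then obtain h d where h: "i = Some (h, d)" by auto
      then have "(h, d) \<in> I" using i by (simp add: I_def)
      then have "\<bar>h x - h y\<bar> < \<delta>" "\<delta> \<le> d" using g \<delta>(2) by force+
      then show False using i by (simp add: h U_def far_def diff_def)
    qed
    then show ?thesis using i by (simp add: U_def close_def diff_def)
  qed
  show thesis
    using I(1,2) \<delta>(1) near by (intro that[of "fst ` I" \<delta>]) auto
qed

definition fine_partition ::
  "'a topology \<Rightarrow> ('a \<Rightarrow> real) set \<Rightarrow> real \<Rightarrow> 'a set \<Rightarrow> ('a \<Rightarrow> 'a \<Rightarrow> real) \<Rightarrow> bool" where
  "fine_partition X G \<delta> J p \<longleftrightarrow> finite J \<and> J \<subseteq> topspace X
     \<and> (\<forall>z\<in>J. continuous_map X euclideanreal (p z))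
     \<and> (\<forall>z\<in>J. \<forall>x\<in>topspace X. 0 \<le> p z x)
     \<and> (\<forall>x\<in>topspace X. (\<Sum>z\<in>J. p z x) = 1)
     \<and> (\<forall>z\<in>J. \<forall>x\<in>topspace X. p z x \<noteq> 0 \<longrightarrow> (\<forall>g\<in>G. \<bar>g x - g z\<bar> < \<delta>))"

lemma fine_partition_exists:
  assumes X: "compact_space X" and G: "finite G" "G \<subseteq> CX X" and \<delta>: "(0::real) < \<delta>"
  shows "\<exists>J p. fine_partition X G \<delta> J p"
proof -
  \<comment> \<open>A product of tents, positive exactly where every \<open>g\<close> in
    \<open>G\<close> differs from \<open>g z\<close> by less than \<open>\<delta>\<close>.\<close>
  define b where "b z x = (\<Prod>g\<in>G. max 0 (\<delta> - \<bar>g x - g z\<bar>))" for z x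
  have cont: "continuous_map X euclideanreal (b z)" for z
    unfolding b_def using G by (intro continuous_intros continuous_map_prod) (auto simp: CX_continuous)
  have b0: "0 \<le> b z x" for z x unfolding b_def by (intro prod_nonneg) auto
  have b1: "0 < b x x" for x unfolding b_def using \<delta> by (intro prod_pos) auto
  have b2: "\<bar>g x - g z\<bar> < \<delta>" if "b z x \<noteq> 0" "g \<in> G" for z x g
    using that G(1) by (auto simp: b_def max_def split: if_splits)
  define U where "U z = {x \<in> topspace X. b z x \<in> {0<..}}" for z
  have "openin X (U z)" for z
    unfolding U_def by (rule openin_continuous_map_preimage[OF cont]) simp
  moreover have "topspace X \<subseteq> (\<Union>z\<in>topspace X. U z)"
    using b1 by (auto simp: U_def)
  ultimately obtain J where J: "finite J" "J \<subseteq> topspace X" "topspace X \<subseteq> (\<Union>z\<in>J. U z)"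
    using compact_space_subcover[OF X, of "topspace X" U] by metis
  have pos: "0 < (\<Sum>z\<in>J. b z x)" if x: "x \<in> topspace X" for x
  proof -
    obtain z where "z \<in> J" "x \<in> U z" using x J(3) by blast
    then show ?thesis using J(1) b0 by (intro sum_pos2[of J z]) (auto simp: U_def)
  qed
  define p where "p z x = b z x / (\<Sum>z\<in>J. b z x)" for z x
  have "continuous_map X euclideanreal (p z)" for z
    unfolding p_def using pos J(1) by (intro continuous_map_real_divide continuous_map_sum cont) force+
  moreover have "0 \<le> p z x" for z x unfolding p_def using b0 by (simp add: sum_nonneg)
  moreover have "(\<Sum>z\<in>J. p z x) = 1" if "x \<in> topspace X" for x
    unfolding p_def using pos[OF that] by (simp flip: sum_divide_distrib)
  moreover have "\<bar>g x - g z\<bar> < \<delta>" if "p z x \<noteq> 0" "g \<in> G" for z x g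
    using b2[of z x g] that by (auto simp: p_def)
  ultimately have "fine_partition X G \<delta> J p"
    unfolding fine_partition_def using J(1,2) by simp
  then show ?thesis by blast
qed

lemma weighted_average_close:
  fixes w a :: "'j \<Rightarrow> real"
  assumes "\<And>z. z \<in> J \<Longrightarrow> 0 \<le> w z" "(\<Sum>z\<in>J. w z) = 1"
    and "\<And>z. \<lbrakk>z \<in> J; w z \<noteq> 0\<rbrakk> \<Longrightarrow> \<bar>a z - b\<bar> \<le> e"
  shows "\<bar>(\<Sum>z\<in>J. w z * a z) - b\<bar> \<le> e"
proof -
  have "(\<Sum>z\<in>J. w z * a z) - b = (\<Sum>z\<in>J. w z * (a z - b))"
    using assms(2) by (simp add: right_diff_distrib sum_subtractf flip: sum_distrib_right)
  also have "\<bar>\<dots>\<bar> \<le> (\<Sum>z\<in>J. w z * e)"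
  proof (rule order_trans[OF sum_abs sum_mono])
    fix z assume z: "z \<in> J"
    show "\<bar>w z * (a z - b)\<bar> \<le> w z * e"
      using assms(1)[OF z] assms(3)[OF z] by (cases "w z = 0") (auto simp: abs_mult intro: mult_left_mono)
  qed
  also have "\<dots> = e" using assms(2) by (simp flip: sum_distrib_right)
  finally show ?thesis .
qed

text \<open>A function is approximated by sampling it, up to a rational error, at the centres of a
  partition of unity that is fine enough for it. The result serves for \<open>X\<close> and again
  for \<open>OH X\<close>.\<close>

lemma countable_dense_CX:
  assumes X: "compact_space X" and D: "separating X D" "countable D"
  obtains E where "countable E" "E \<subseteq> CX X"
    "\<And>f e. \<lbrakk>f \<in> CX X; 0 < e\<rbrakk> \<Longrightarrow> \<exists>g\<in>E. \<forall>x\<in>topspace X. \<bar>g x - f x\<bar> \<le> e"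
proof -
  have D': "D \<subseteq> CX X" using D by (simp add: separating_def)
  let ?GS = "{G. finite G \<and> G \<subseteq> D} \<times> (UNIV :: nat set)"
  \<comment> \<open>One partition is fixed for each finite \<open>G\<close> and each mesh
    \<open>1 / (n + 1)\<close>, which keeps the family countable.\<close>
  define J where "J G n = (SOME J. \<exists>p. fine_partition X G (1 / real (Suc n)) J p)" for G n
  define p where "p G n = (SOME p. fine_partition X G (1 / real (Suc n)) (J G n) p)" for G n
  have part: "fine_partition X G (1 / real (Suc n)) (J G n) (p G n)" if "finite G" "G \<subseteq> D" for G n
  proof -
    have "\<exists>J p. fine_partition X G (1 / real (Suc n)) J p"
      by (rule fine_partition_exists[OF X that(1)]) (use that D' in auto)
    then have "\<exists>p. fine_partition X G (1 / real (Suc n)) (J G n) p"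
      unfolding J_def by (rule someI_ex)
    then show ?thesis unfolding p_def by (rule someI_ex)
  qed
  define comb where "comb G n q = (\<lambda>x\<in>topspace X. \<Sum>z\<in>J G n. p G n z x * q z)" for G n and q :: "'a \<Rightarrow> real"
  define E where "E = (\<Union>(G, n)\<in>?GS. comb G n ` (PiE (J G n) (\<lambda>_. \<rat>)))"
  show thesis
  proof (rule that)
    have "countable (comb G n ` PiE (J G n) (\<lambda>_. \<rat>))" if "finite G" "G \<subseteq> D" for G n
      using part[OF that, of n] by (intro countable_image countable_PiE) (auto simp: fine_partition_def countable_rat)
    then show "countable E"
      unfolding E_def using D(2)
      by (intro countable_UN countable_SIGMA countable_Collect_finite_subset) auto
    show "E \<subseteq> CX X"
    proof -
      have "comb G n q \<in> CX X" if "finite G" "G \<subseteq> D" for G n q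
        unfolding comb_def using part[OF that, of n] unfolding fine_partition_def
        by (intro restrict_in_CX continuous_intros continuous_map_sum) auto
      then show ?thesis by (auto simp: E_def)
    qed
    fix f and e :: real assume f: "f \<in> CX X" and e: "0 < e"
    from e have "0 < e / 2" by simp
    from separating_uniform[OF X D(1) f this] obtain G \<delta> where G: "finite G" "G \<subseteq> D" "0 < \<delta>"
      and close: "\<And>x y. \<lbrakk>x \<in> topspace X; y \<in> topspace X; \<forall>g\<in>G. \<bar>g x - g y\<bar> < \<delta>\<rbrakk> \<Longrightarrow> \<bar>f x - f y\<bar> < e / 2"
      by blast
    obtain n where n: "1 / real (Suc n) < \<delta>" using nat_approx_posE[OF G(3)] by blast
    let ?J = "J G n" and ?p = "p G n"
    have part': "fine_partition X G (1 / real (Suc n)) ?J ?p" using part G by blast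
    have "\<exists>q\<in>\<rat>. \<bar>q - f z\<bar> < e / 2" for z
    proof -
      obtain q where "q \<in> \<rat>" "f z - e / 2 < q" "q < f z + e / 2"
        using Rats_dense_in_real[of "f z - e / 2" "f z + e / 2"] e by auto
      then have "\<bar>q - f z\<bar> < e / 2" by linarith
      with \<open>q \<in> \<rat>\<close> show ?thesis by blast
    qed
    then obtain q where q: "\<And>z. q z \<in> \<rat>" "\<And>z. \<bar>q z - f z\<bar> < e / 2" by metis
    have "comb G n (restrict q ?J) \<in> E"
      unfolding E_def by (rule UN_I[of "(G, n)"]) (auto simp: G q(1))
    moreover have "\<bar>comb G n (restrict q ?J) x - f x\<bar> \<le> e" if x: "x \<in> topspace X" for x
    proof -
      have "\<bar>(\<Sum>z\<in>?J. ?p z x * restrict q ?J z) - f x\<bar> \<le> e"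
      proof (rule weighted_average_close)
        show "0 \<le> ?p z x" if "z \<in> ?J" for z using part' that x by (simp add: fine_partition_def)
        show "(\<Sum>z\<in>?J. ?p z x) = 1" using part' x by (simp add: fine_partition_def)
        fix z assume z: "z \<in> ?J" "?p z x \<noteq> 0"
        have "\<bar>f x - f z\<bar> < e / 2"
        proof (rule close)
          show "z \<in> topspace X" using part' z unfolding fine_partition_def by blast
          have "\<forall>g\<in>G. \<bar>g x - g z\<bar> < 1 / real (Suc n)" using part' z x unfolding fine_partition_def by blast
          then show "\<forall>g\<in>G. \<bar>g x - g z\<bar> < \<delta>" using n by force
        qed (fact x)
        moreover have "restrict q ?J z = q z" using z(1) by simp
        ultimately show "\<bar>restrict q ?J z - f x\<bar> \<le> e" using q(2)[of z] by linarith
      qed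
      then show ?thesis using x by (simp add: comb_def)
    qed
    ultimately show "\<exists>g\<in>E. \<forall>x\<in>topspace X. \<bar>g x - f x\<bar> \<le> e" by blast
  qed
qed

text \<open>Distances to the points of finite nets separate: a net point closer to \<open>x\<close>
  than \<open>d x y / 2\<close> is farther than that from \<open>y\<close>.\<close>

lemma metrizable_imp_countable_separating:
  assumes "compact_space X" "metrizable_space X"
  obtains D where "separating X D" "countable D"
proof -
  obtain M d where "Metric_space M d" and X: "X = Metric_space.mtopology M d"
    using assms(2) by (auto simp: metrizable_space_def)
  interpret Metric_space M d by fact
  have "mtotally_bounded M"
    using assms(1) compactin_imp_mtotally_bounded[of M] by (simp add: X compact_space_def)
  then have "\<forall>n. \<exists>K. finite K \<and> K \<subseteq> M \<and> M \<subseteq> (\<Union>x\<in>K. mball x (1 / real (Suc n)))"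
    unfolding mtotally_bounded_def by (metis of_nat_0_less_iff zero_less_Suc zero_less_divide_1_iff)
  then obtain K where K: "\<And>n. finite (K n)" "\<And>n. K n \<subseteq> M" "\<And>n. M \<subseteq> (\<Union>x\<in>K n. mball x (1 / real (Suc n)))"
    by metis
  let ?D = "(\<lambda>z. \<lambda>x\<in>M. d z x) ` (\<Union>n. K n)"
  have CX: "(\<lambda>x\<in>M. d z x) \<in> CX X" if "z \<in> M" for z
  proof -
    have "continuous_map X euclideanreal (d z)"
      unfolding X using that continuous_map_mdist[of mtopology "metric (M, d)" "\<lambda>_. z" "\<lambda>x. x"] by simp
    from restrict_in_CX[OF this] show ?thesis by (simp add: X)
  qed
  have "\<exists>g\<in>?D. g x \<noteq> g y" if xy: "x \<in> M" "y \<in> M" "x \<noteq> y" for x y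
  proof -
    obtain n where n: "1 / real (Suc n) < d x y / 2" using nat_approx_posE[of "d x y / 2"] xy by auto
    obtain z where z: "z \<in> K n" "x \<in> mball z (1 / real (Suc n))" using K(3) xy by blast
    then have "d z x < d x y / 2" "z \<in> M" using n by auto
    then have "d z x \<noteq> d z y" using triangle[of x z y] xy commute[of x z] by auto
    then show ?thesis using z xy by (intro bexI[of _ "\<lambda>x\<in>M. d z x"]) auto
  qed
  then have "separating X ?D"
    unfolding separating_def using K(2) CX by (simp add: X image_subset_iff UN_subset_iff) blast
  moreover have "countable ?D" using K(1) by (intro countable_image countable_UN) (auto intro: countable_finite)
  ultimately show thesis using that by blast
qed

section \<open>Test functions on the space of functionals\<close>

abbreviation evals :: "'a topology \<Rightarrow> ((('a \<Rightarrow> real) \<Rightarrow> real) \<Rightarrow> real) set" where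
  "evals X \<equiv> evaluation X ` CX X"

text \<open>The unit of the monad.\<close>

definition dirac :: "'a topology \<Rightarrow> 'a \<Rightarrow> ('a \<Rightarrow> real) \<Rightarrow> real" where
  "dirac X x = (\<lambda>\<phi>\<in>CX X. \<phi> x)"

lemma dirac_OH_set: "x \<in> topspace X \<Longrightarrow> dirac X x \<in> OH_set X"
  unfolding OH_set_iff by (auto simp: dirac_def affine_fn_CX)

lemma dirac_apply [simp]: "\<phi> \<in> CX X \<Longrightarrow> dirac X x \<phi> = \<phi> x"
  by (simp add: dirac_def)

lemma OH_set_nonempty: "topspace X \<noteq> {} \<Longrightarrow> OH_set X \<noteq> {}"
  using dirac_OH_set[of _ X] by force

text \<open>For finitely many such functions one can choose maximum points that are not minimum points chosen
  for the others.\<close>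
definition extremes_infinite :: "'a topology \<Rightarrow> ('a \<Rightarrow> real) \<Rightarrow> bool" where
  "extremes_infinite Y h \<longleftrightarrow> infinite {p \<in> topspace Y. \<forall>y\<in>topspace Y. h y \<le> h p}
     \<and> infinite {p \<in> topspace Y. \<forall>y\<in>topspace Y. h p \<le> h y}"

definition clip :: "'a topology \<Rightarrow> ('a \<Rightarrow> real) \<Rightarrow> 'a \<Rightarrow> real" where
  "clip Y f = (\<lambda>y\<in>topspace Y. max 0 (min 1 (f y)))"

lemma clip_CX: "continuous_map Y euclideanreal f \<Longrightarrow> clip Y f \<in> CX Y"
  unfolding clip_def by (intro restrict_in_CX continuous_intros) simp_all

lemma clip_apply: "y \<in> topspace Y \<Longrightarrow> clip Y f y = max 0 (min 1 (f y))"
  by (simp add: clip_def)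

text \<open>A minorant of \<open>g\<close> from \<open>A\<close> is at most \<open>0\<close>, because its maximum is, and a majorant is at least \<open>1\<close>:
  the values of a functional on \<open>A\<close> do not restrict its value at \<open>g\<close>.\<close>
definition free_for :: "'a topology \<Rightarrow> ('a \<Rightarrow> real) set \<Rightarrow> ('a \<Rightarrow> real) \<Rightarrow> bool" where
  "free_for Y A g \<longleftrightarrow> (\<forall>h\<in>A.
     (\<exists>p\<in>topspace Y. (\<forall>y\<in>topspace Y. h y \<le> h p) \<and> g p \<le> 0) \<and>
     (\<exists>p\<in>topspace Y. (\<forall>y\<in>topspace Y. h p \<le> h y) \<and> 1 \<le> g p))"

lemma lower_ext_free:
  assumes Y: "compact_space Y" and A: "affine_cone Y A" and M: "M \<in> OH_set Y" and g: "g \<in> CX Y"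
    and free: "free_for Y A g"
  shows "lower_ext Y A M g \<le> 0" "1 \<le> upper_ext Y A M g"
proof -
  show "lower_ext Y A M g \<le> 0"
  proof (rule lower_ext_le[OF Y A g])
    fix h assume h: "h \<in> A" "le_on Y h g"
    then obtain p where p: "p \<in> topspace Y" "\<And>y. y \<in> topspace Y \<Longrightarrow> h y \<le> h p" "g p \<le> 0"
      using free unfolding free_for_def by blast
    have "h p \<le> g p" using h(2) p(1) by blast
    then have "h y \<le> 0" if "y \<in> topspace Y" for y using p(2)[OF that] p(3) by linarith
    then show "M h \<le> 0" by (rule OH_set_le_const[OF M affine_cone_CX[OF A h(1)]])
  qed
  show "1 \<le> upper_ext Y A M g"
  proof (rule upper_ext_ge[OF Y A g])
    fix h assume h: "h \<in> A" "le_on Y g h"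
    then obtain p where p: "p \<in> topspace Y" "\<And>y. y \<in> topspace Y \<Longrightarrow> h p \<le> h y" "1 \<le> g p"
      using free unfolding free_for_def by blast
    have "g p \<le> h p" using h(2) p(1) by blast
    then have "1 \<le> h y" if "y \<in> topspace Y" for y using p(2)[OF that] p(3) by linarith
    then show "1 \<le> M h" by (rule OH_set_ge_const[OF M affine_cone_CX[OF A h(1)]])
  qed
qed

text \<open>For \<open>0 \<le> a\<close> an extreme point of \<open>d\<close> stays one for
  \<open>a * d + b\<close>.\<close>

lemma free_for_ray:
  assumes "free_for Y {d} g" shows "free_for Y (affine_ray Y d) g"
  unfolding free_for_def
proof
  fix h assume "h \<in> affine_ray Y d"
  then obtain a b where h: "h = affine_fn Y a b d" "0 \<le> a" by (auto simp: affine_ray_def)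
  obtain p q where "p \<in> topspace Y" "\<And>y. y \<in> topspace Y \<Longrightarrow> d y \<le> d p" "g p \<le> 0"
      "q \<in> topspace Y" "\<And>y. y \<in> topspace Y \<Longrightarrow> d q \<le> d y" "1 \<le> g q"
    using assms unfolding free_for_def by auto
  then show "(\<exists>p\<in>topspace Y. le_on Y h (\<lambda>y. h p) \<and> g p \<le> 0) \<and>
      (\<exists>p\<in>topspace Y. le_on Y (\<lambda>y. h p) h \<and> 1 \<le> g p)"
    using h by (intro conjI bexI[of _ p] bexI[of _ q]) (auto intro: mult_left_mono)
qed

text \<open>A union of cones without any sums. It is again an affine cone, since that notion, like
  the axioms, never adds two functions.\<close>

definition ray_span :: "'a topology \<Rightarrow> ((('a \<Rightarrow> real) \<Rightarrow> real) \<Rightarrow> real) set \<Rightarrow> ((('a \<Rightarrow> real) \<Rightarrow> real) \<Rightarrow> real) set" where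
  "ray_span X E = evals X \<union> (\<Union>d\<in>E. affine_ray (OH X) d)"

lemma neg_fn_span: "neg_fn (OH X) ` ray_span X E = neg_fn (OH X) ` evals X \<union> (\<Union>d\<in>E. affine_ray (OH X) (neg_fn (OH X) d))"
  unfolding ray_span_def image_Un image_UN neg_affine_ray ..

lemma affine_cone_Un_UN:
  assumes A: "affine_cone Y A" and R: "\<And>d. d \<in> E \<Longrightarrow> affine_cone Y (R d)"
  shows "affine_cone Y (A \<union> (\<Union>d\<in>E. R d))"
  unfolding affine_cone_def
proof (intro conjI ballI allI impI)
  show "A \<union> (\<Union>d\<in>E. R d) \<subseteq> CX Y" using affine_cone_CX[OF A] affine_cone_CX[OF R] by auto
  show "A \<union> (\<Union>d\<in>E. R d) \<noteq> {}" using A by (auto simp: affine_cone_def)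
  fix h and a b :: real assume h: "h \<in> A \<union> (\<Union>d\<in>E. R d)" and a: "0 \<le> a"
  from h show "affine_fn Y a b h \<in> A \<union> (\<Union>d\<in>E. R d)"
  proof
    assume "h \<in> A"
    then show ?thesis by (rule UnI1[OF affine_cone_affine[OF A _ a]])
  next
    assume "h \<in> (\<Union>d\<in>E. R d)"
    then obtain d where d: "d \<in> E" "h \<in> R d" by blast
    from affine_cone_affine[OF R[OF d(1)] d(2) a] d(1) show ?thesis by blast
  qed
qed

lemma finitely_dominated_UN_ray:
  assumes Y: "compact_space Y" "topspace Y \<noteq> {}" and F: "F \<in> CX Y"
    and A: "finitely_dominated Y A F" and E: "finite E" "\<And>d. d \<in> E \<Longrightarrow> k d \<in> CX Y"
  shows "finitely_dominated Y (A \<union> (\<Union>d\<in>E. affine_ray Y (k d))) F"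
  using E
proof (induction E rule: finite_induct)
  case empty
  then show ?case using A by simp
next
  case (insert d E)
  have "finitely_dominated Y ((A \<union> (\<Union>d\<in>E. affine_ray Y (k d))) \<union> affine_ray Y (k d)) F"
    by (rule finitely_dominated_Un[OF _ finitely_dominated_ray[OF Y F]]) (use insert in simp_all)
  moreover have "(A \<union> (\<Union>d\<in>E. affine_ray Y (k d))) \<union> affine_ray Y (k d) = A \<union> (\<Union>d\<in>insert d E. affine_ray Y (k d))"
    by auto
  ultimately show ?case by simp
qed

lemma span_mono: "E \<subseteq> E' \<Longrightarrow> ray_span X E \<subseteq> ray_span X E'"
  unfolding ray_span_def by blast

lemma mem_span: "d \<in> E \<Longrightarrow> d \<in> CX (OH X) \<Longrightarrow> d \<in> ray_span X E"
  unfolding ray_span_def using mem_affine_ray[of d "OH X"] by blast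

lemma topspace_Hilbert_cube: "topspace Hilbert_cube = cube"
  by (auto simp: Hilbert_cube_def PiE_def Pi_def)

section \<open>Evaluations on the space of functionals and their finite domination\<close>

locale nonempty_compact =
  fixes X :: "'a topology"
  assumes compact_X: "compact_space X" and nonempty_X: "topspace X \<noteq> {}"
begin

lemma topspace_OH: "topspace (OH X) = OH_set X"
  by (rule OH_eq(2)[OF compact_X nonempty_X])

lemma compact_OH: "compact_space (OH X)"
  by (rule OH_eq(3)[OF compact_X nonempty_X])

lemma nonempty_OH: "topspace (OH X) \<noteq> {}"
  unfolding topspace_OH by (rule OH_set_nonempty[OF nonempty_X])

lemma evaluation_apply: "\<nu> \<in> OH_set X \<Longrightarrow> evaluation X \<phi> \<nu> = \<nu> \<phi>"
  by (simp add: evaluation_def topspace_OH)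

lemma evaluation_CX: "\<phi> \<in> CX X \<Longrightarrow> evaluation X \<phi> \<in> CX (OH X)"
  unfolding evaluation_def
  by (intro restrict_in_CX continuous_map_OH_eval compact_X nonempty_X)

lemma affine_fn_evaluation:
  assumes "\<phi> \<in> CX X" "0 \<le> a"
  shows "affine_fn (OH X) a b (evaluation X \<phi>) = evaluation X (affine_fn X a b \<phi>)"
  using assms by (intro CX_eqI[where Y = "OH X"])
    (auto simp: evaluation_CX affine_fn_CX topspace_OH evaluation_apply OH_set_affine)

lemma affine_cone_evals: "affine_cone (OH X) (evals X)"
  unfolding affine_cone_def
proof (intro conjI ballI allI impI)
  show "evals X \<subseteq> CX (OH X)" using evaluation_CX by blast
  show "evals X \<noteq> {}" using const_fn_CX[of X 0] by blast
  fix h and a b :: real assume "h \<in> evals X" "0 \<le> a"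
  then show "affine_fn (OH X) a b h \<in> evals X"
    by (auto simp: affine_fn_evaluation affine_fn_CX)
qed

text \<open>Functionals are 1-Lipschitz for the sup norm, so their values on a dense set determine
  them; \<open>e\<close> is a third of the gap to be excluded.\<close>

lemma separating_evaluations:
  assumes E: "E \<subseteq> CX X" and dense: "\<And>f e. \<lbrakk>f \<in> CX X; 0 < e\<rbrakk> \<Longrightarrow> \<exists>g\<in>E. \<forall>x\<in>topspace X. \<bar>g x - f x\<bar> \<le> e"
  shows "separating (OH X) (evaluation X ` E)"
  unfolding separating_def topspace_OH
proof (intro conjI ballI impI)
  show "evaluation X ` E \<subseteq> CX (OH X)" using E evaluation_CX by blast
  fix \<nu> \<nu>' assume \<nu>: "\<nu> \<in> OH_set X" "\<nu>' \<in> OH_set X" "\<nu> \<noteq> \<nu>'"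
  show "\<exists>g\<in>evaluation X ` E. g \<nu> \<noteq> g \<nu>'"
  proof (rule ccontr)
    assume "\<not> (\<exists>g\<in>evaluation X ` E. g \<nu> \<noteq> g \<nu>')"
    then have eq: "\<nu> g = \<nu>' g" if "g \<in> E" for g
      using that \<nu> by (auto simp: evaluation_apply)
    have "\<nu> f = \<nu>' f" if f: "f \<in> CX X" for f
    proof (rule ccontr)
      assume ne: "\<nu> f \<noteq> \<nu>' f"
      define e where "e = \<bar>\<nu> f - \<nu>' f\<bar> / 3"
      have "0 < e" using ne by (simp add: e_def)
      then obtain g where g: "g \<in> E" "\<forall>x\<in>topspace X. \<bar>g x - f x\<bar> \<le> e" using dense[OF f] by blast
      have "g \<in> CX X" using g E by blast
      have "\<And>x. x \<in> topspace X \<Longrightarrow> f x \<le> g x + e" "\<And>x. x \<in> topspace X \<Longrightarrow> g x \<le> f x + e"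
        using g(2) by (force simp: abs_le_iff)+
      then have "\<nu> f \<le> \<nu> g + e" "\<nu> g \<le> \<nu> f + e" "\<nu>' f \<le> \<nu>' g + e" "\<nu>' g \<le> \<nu>' f + e"
        using OH_set_le_add[OF \<nu>(1)] OH_set_le_add[OF \<nu>(2)] f \<open>g \<in> CX X\<close> by metis+
      then have "\<bar>\<nu> f - \<nu>' f\<bar> \<le> 2 * e" using eq[OF g(1)] by linarith
      then show False using \<open>0 < e\<close> by (simp add: e_def)
    qed
    then show False using OH_set_eqI \<nu> by blast
  qed
qed

text \<open>The evaluations below \<open>F\<close> may form an infinite-dimensional family. Sampling
  \<open>\<phi>\<close> near its maxima on the pieces of a partition of unity replaces it by an
  average that dominates it up to a small error and has only finitely many parameters, to which
  \<open>dickson_real\<close> applies. That the average, slightly lowered, stays below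
  \<open>F\<close> rests on uniform continuity of \<open>F\<close> with respect to finitely many
  evaluations.\<close>

lemma finitely_dominated_evals:
  assumes F: "F \<in> CX (OH X)"
  shows "finitely_dominated (OH X) (evals X) F"
  unfolding finitely_dominated_def
proof (intro allI impI)
  fix e0 :: real assume e0: "0 < e0"
  \<comment> \<open>The three thirds of \<open>e0\<close> pay for the near maximum in
    \<open>picks\<close>, for the rounding in \<open>dickson_real\<close> and for the shift in
    \<open>T\<close>.\<close>
  define e where "e = e0 / 3"
  have e: "0 < e" using e0 by (simp add: e_def)
  have sep: "separating (OH X) (evals X)"
    by (rule separating_evaluations) (use order_refl in \<open>force+\<close>)
  obtain G' \<delta> where G': "finite G'" "G' \<subseteq> evals X" and \<delta>: "0 < \<delta>"
    and near': "\<And>\<nu> \<nu>'. \<lbrakk>\<nu> \<in> topspace (OH X); \<nu>' \<in> topspace (OH X); \<forall>g\<in>G'. \<bar>g \<nu> - g \<nu>'\<bar> < \<delta>\<rbrakk> \<Longrightarrow> \<bar>F \<nu> - F \<nu>'\<bar> < e"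
    by (rule separating_uniform[OF compact_OH sep F e]) blast
  obtain G where G: "G \<subseteq> CX X" "finite G" "G' = evaluation X ` G"
    using finite_subset_image[OF G'] by (elim exE conjE)
  have near: "\<bar>F \<nu> - F \<nu>'\<bar> < e"
    if "\<nu> \<in> OH_set X" "\<nu>' \<in> OH_set X" "\<And>g. g \<in> G \<Longrightarrow> \<bar>\<nu> g - \<nu>' g\<bar> < \<delta>" for \<nu> \<nu>'
    using that by (intro near') (auto simp: topspace_OH G(3) evaluation_apply)
  have "0 < \<delta> / 3" using \<delta> by simp
  from fine_partition_exists[OF compact_X G(2,1) this]
  obtain J p where part: "fine_partition X G (\<delta> / 3) J p" by (elim exE)
  then have J: "finite J" "J \<subseteq> topspace X"
    and p_cont: "\<And>z. z \<in> J \<Longrightarrow> continuous_map X euclideanreal (p z)"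
    and p_ge: "\<And>z x. \<lbrakk>z \<in> J; x \<in> topspace X\<rbrakk> \<Longrightarrow> 0 \<le> p z x"
    and p_sum: "\<And>x. x \<in> topspace X \<Longrightarrow> (\<Sum>z\<in>J. p z x) = 1"
    and p_fine: "\<And>z x g. \<lbrakk>z \<in> J; x \<in> topspace X; p z x \<noteq> 0; g \<in> G\<rbrakk> \<Longrightarrow> \<bar>g x - g z\<bar> < \<delta> / 3"
    unfolding fine_partition_def by blast+
  define U where "U z = {x \<in> topspace X. p z x \<noteq> 0}" for z
  \<comment> \<open>A sample point where \<open>\<phi>\<close> is nearly maximal on the piece, so
    that averages of samples do not fall far below \<open>\<phi>\<close>; for an empty piece any
    point will do.\<close>
  define picks where "picks \<phi> z x \<longleftrightarrow> x \<in> topspace X \<and> (U z \<noteq> {} \<longrightarrow> x \<in> U z)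
      \<and> (\<forall>y\<in>U z. \<phi> y \<le> \<phi> x + e)" for \<phi> :: "'a \<Rightarrow> real" and z x
  have "\<exists>x. picks \<phi> z x" if \<phi>: "\<phi> \<in> CX X" and z: "z \<in> J" for \<phi> z
  proof (cases "U z = {}")
    case True
    then show ?thesis using z J(2) unfolding picks_def by auto
  next
    case False
    obtain C where C: "\<And>y. y \<in> topspace X \<Longrightarrow> \<bar>\<phi> y\<bar> \<le> C" by (rule CX_bounded[OF compact_X \<phi>]) blast
    have bdd: "bdd_above (\<phi> ` U z)"
      using C by (intro bdd_aboveI2[of _ _ C]) (auto simp: U_def abs_le_iff)
    obtain x where x: "x \<in> U z" "Sup (\<phi> ` U z) - e < \<phi> x"
      using less_cSupD[of "\<phi> ` U z" "Sup (\<phi> ` U z) - e"] False e by auto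
    have "\<phi> y \<le> \<phi> x + e" if "y \<in> U z" for y
      using cSup_upper[OF imageI[OF that] bdd] x(2) by linarith
    then show ?thesis using x(1) unfolding picks_def by (auto simp: U_def)
  qed
  then obtain c where c: "\<And>\<phi> z. \<lbrakk>\<phi> \<in> CX X; z \<in> J\<rbrakk> \<Longrightarrow> picks \<phi> z (c \<phi> z)" by metis
  define avg where "avg s g = (\<lambda>x\<in>topspace X. \<Sum>z\<in>J. p z x * g (s z))" for s and g :: "'a \<Rightarrow> real"
  have avg_CX: "avg s g \<in> CX X" for s g
    unfolding avg_def using J(1) by (intro restrict_in_CX continuous_map_sum continuous_intros p_cont)
  \<comment> \<open>\<open>\<nu>\<close> composed with averaging. For samples in \<open>X\<close>
    the averaging operator is monotone and fixes constants, so the result is a functional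
    again.\<close>
  define K where "K s \<nu> = (\<lambda>g\<in>CX X. \<nu> (avg s g))" for s and \<nu> :: "('a \<Rightarrow> real) \<Rightarrow> real"
  have K: "K s \<nu> \<in> OH_set X" if \<nu>: "\<nu> \<in> OH_set X" and s: "\<And>z. z \<in> J \<Longrightarrow> s z \<in> topspace X" for s \<nu>
    unfolding OH_set_iff
  proof (intro conjI ballI allI impI)
    show "K s \<nu> \<in> extensional (CX X)" by (simp add: K_def)
    fix f and a b :: real assume f: "f \<in> CX X" and a: "0 \<le> a"
    have "avg s (affine_fn X a b f) = affine_fn X a b (avg s f)"
    proof (rule CX_eqI[OF avg_CX affine_fn_CX[OF avg_CX]])
      fix x assume x: "x \<in> topspace X"
      have "(\<Sum>z\<in>J. p z x * (a * f (s z) + b)) = a * (\<Sum>z\<in>J. p z x * f (s z)) + (\<Sum>z\<in>J. p z x) * b"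
        by (simp add: sum_distrib_left sum_distrib_right sum.distrib algebra_simps)
      then show "avg s (affine_fn X a b f) x = affine_fn X a b (avg s f) x"
        using x s p_sum[OF x] by (simp add: avg_def)
    qed
    then show "K s \<nu> (affine_fn X a b f) = a * K s \<nu> f + b"
      using f a by (simp add: K_def affine_fn_CX OH_set_affine[OF \<nu> avg_CX])
  next
    fix f g assume fg: "f \<in> CX X" "g \<in> CX X" "le_on X f g"
    have "\<nu> (avg s f) \<le> \<nu> (avg s g)"
    proof (rule OH_set_mono[OF \<nu> avg_CX avg_CX], intro ballI)
      fix x assume "x \<in> topspace X"
      then show "avg s f x \<le> avg s g x"
        using p_ge s fg(3) by (auto simp: avg_def intro!: sum_mono mult_left_mono)
    qed
    then show "K s \<nu> f \<le> K s \<nu> g" using fg by (simp add: K_def)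
  qed
  let ?\<Phi> = "{\<phi> \<in> CX X. \<forall>\<nu>\<in>OH_set X. \<nu> \<phi> \<le> F \<nu>}"
  \<comment> \<open>\<open>T \<phi>\<close> is again a minorant of \<open>F\<close>, as \<open>\<nu> (avg s \<phi>) = K s \<nu> \<phi>\<close> and \<open>K s \<nu>\<close> is close to \<open>\<nu>\<close>; it almost
    dominates \<open>\<phi>\<close>, and ranges over a finite-dimensional space.\<close>
  define T where "T \<phi> = affine_fn X 1 (- e) (avg (c \<phi>) \<phi>)" for \<phi>
  have cX: "c \<phi> z \<in> topspace X" if "\<phi> \<in> CX X" "z \<in> J" for \<phi> z
    using c[OF that] by (simp add: picks_def)
  have T: "T \<phi> \<in> ?\<Phi>" if \<phi>: "\<phi> \<in> ?\<Phi>" for \<phi>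
  proof -
    have \<phi>': "\<phi> \<in> CX X" using \<phi> by simp
    have "\<nu> (T \<phi>) \<le> F \<nu>" if \<nu>: "\<nu> \<in> OH_set X" for \<nu>
    proof -
      let ?\<nu>' = "K (c \<phi>) \<nu>"
      have \<nu>': "?\<nu>' \<in> OH_set X" by (rule K[OF \<nu> cX[OF \<phi>']])
      have "\<bar>?\<nu>' g - \<nu> g\<bar> < \<delta>" if g: "g \<in> G" for g
      proof -
        have gC: "g \<in> CX X" using g G(1) by blast
        \<comment> \<open>Both \<open>x\<close> and the sample lie in the piece of \<open>z\<close>,
          each within \<open>\<delta> / 3\<close> of the centre as measured by
          \<open>g\<close>.\<close>
        have close: "\<bar>avg (c \<phi>) g x - g x\<bar> \<le> 2 * \<delta> / 3" if x: "x \<in> topspace X" for x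
        proof -
          have "\<bar>(\<Sum>z\<in>J. p z x * g (c \<phi> z)) - g x\<bar> \<le> 2 * \<delta> / 3"
          proof (rule weighted_average_close[OF p_ge[OF _ x] p_sum[OF x]])
            fix z assume z: "z \<in> J" "p z x \<noteq> 0"
            then have "x \<in> U z" using x by (simp add: U_def)
            then have "c \<phi> z \<in> U z" using c[OF \<phi>' z(1)] by (auto simp: picks_def)
            then have "\<bar>g (c \<phi> z) - g z\<bar> < \<delta> / 3" using p_fine z g by (simp add: U_def)
            moreover have "\<bar>g x - g z\<bar> < \<delta> / 3" using p_fine z g x by simp
            ultimately show "\<bar>g (c \<phi> z) - g x\<bar> \<le> 2 * \<delta> / 3" by linarith
          qed
          then show ?thesis using x by (simp add: avg_def)
        qed
        have close': "avg (c \<phi>) g x \<le> g x + 2 * \<delta> / 3" "g x \<le> avg (c \<phi>) g x + 2 * \<delta> / 3"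
          if "x \<in> topspace X" for x
          using close[OF that] by linarith+
        have "\<nu> (avg (c \<phi>) g) \<le> \<nu> g + 2 * \<delta> / 3"
          by (rule OH_set_le_add[OF \<nu> avg_CX gC close'(1)])
        moreover have "\<nu> g \<le> \<nu> (avg (c \<phi>) g) + 2 * \<delta> / 3"
          by (rule OH_set_le_add[OF \<nu> gC avg_CX close'(2)])
        ultimately show ?thesis using gC \<delta> by (simp add: K_def abs_less_iff)
      qed
      then have "\<bar>F ?\<nu>' - F \<nu>\<bar> < e" by (rule near[OF \<nu>' \<nu>])
      moreover have "?\<nu>' \<phi> \<le> F ?\<nu>'" using \<phi> \<nu>' by simp
      moreover have "\<nu> (T \<phi>) = ?\<nu>' \<phi> - e"
        using \<phi>' by (simp add: T_def K_def OH_set_affine[OF \<nu> avg_CX])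
      ultimately show ?thesis by linarith
    qed
    then show ?thesis by (simp add: T_def affine_fn_CX avg_CX)
  qed
  obtain C where C: "\<And>\<nu>. \<nu> \<in> topspace (OH X) \<Longrightarrow> \<bar>F \<nu>\<bar> \<le> C" by (rule CX_bounded[OF compact_OH F]) blast
  \<comment> \<open>The upper bound that \<open>dickson_real\<close> requires: testing a minorant at
    a Dirac functional gives \<open>\<phi> x \<le> F (dirac X x)\<close>.\<close>
  have bound: "\<phi> (c \<phi> z) \<le> C" if \<phi>: "\<phi> \<in> ?\<Phi>" and z: "z \<in> J" for \<phi> z
  proof -
    have d: "dirac X (c \<phi> z) \<in> OH_set X" using \<phi> z by (intro dirac_OH_set cX) auto
    then have "dirac X (c \<phi> z) \<phi> \<le> F (dirac X (c \<phi> z))" using \<phi> by blast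
    then show ?thesis using C[of "dirac X (c \<phi> z)"] d \<phi> by (simp add: topspace_OH abs_le_iff)
  qed
  have "\<exists>B. finite B \<and> B \<subseteq> ?\<Phi> \<and> (\<forall>\<phi>\<in>?\<Phi>. \<exists>\<psi>\<in>B. \<forall>z\<in>J. \<phi> (c \<phi> z) \<le> \<psi> (c \<psi> z) + e)"
    by (rule dickson_real[where c = "\<lambda>\<phi> z. \<phi> (c \<phi> z)" and C = C]) (rule J(1), erule (1) bound, rule e)
  then obtain B where B: "finite B" "B \<subseteq> ?\<Phi>" "\<forall>\<phi>\<in>?\<Phi>. \<exists>\<psi>\<in>B. \<forall>z\<in>J. \<phi> (c \<phi> z) \<le> \<psi> (c \<psi> z) + e"
    by (elim exE conjE)
  have le_T: "\<phi> x \<le> T \<psi> x + e0"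
    if \<phi>: "\<phi> \<in> ?\<Phi>" and \<psi>: "\<forall>z\<in>J. \<phi> (c \<phi> z) \<le> \<psi> (c \<psi> z) + e" and x: "x \<in> topspace X" for \<phi> \<psi> x
  proof -
    have "\<phi> x = (\<Sum>z\<in>J. p z x * \<phi> x)" using p_sum[OF x] by (simp flip: sum_distrib_right)
    also have "\<dots> \<le> (\<Sum>z\<in>J. p z x * (\<psi> (c \<psi> z) + 2 * e))"
    proof (rule sum_mono)
      fix z assume z: "z \<in> J"
      show "p z x * \<phi> x \<le> p z x * (\<psi> (c \<psi> z) + 2 * e)"
      proof (cases "p z x = 0")
        case False
        then have "x \<in> U z" using x by (simp add: U_def)
        then have "\<phi> x \<le> \<phi> (c \<phi> z) + e" using c[of \<phi> z] \<phi> z by (simp add: picks_def)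
        then have "\<phi> x \<le> \<psi> (c \<psi> z) + 2 * e" using bspec[OF \<psi> z] by linarith
        then show ?thesis using p_ge[OF z x] by (rule mult_left_mono)
      qed simp
    qed
    also have "\<dots> = (\<Sum>z\<in>J. p z x * \<psi> (c \<psi> z)) + 2 * e"
      using p_sum[OF x] by (simp add: distrib_left sum.distrib flip: sum_distrib_right)
    finally show ?thesis using x by (simp add: T_def avg_def e_def field_simps)
  qed
  show "\<exists>B. finite B \<and> B \<subseteq> {h \<in> evals X. le_on (OH X) h F} \<and>
     (\<forall>h\<in>evals X. le_on (OH X) h F \<longrightarrow> (\<exists>k\<in>B. \<forall>\<nu>\<in>topspace (OH X). h \<nu> \<le> k \<nu> + e0))"
  proof (intro exI[of _ "(\<lambda>\<phi>. evaluation X (T \<phi>)) ` B"] conjI ballI impI)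
    show "finite ((\<lambda>\<phi>. evaluation X (T \<phi>)) ` B)" using B(1) by simp
    show "(\<lambda>\<phi>. evaluation X (T \<phi>)) ` B \<subseteq> {h \<in> evals X. le_on (OH X) h F}"
      using T B(2) by (auto simp: topspace_OH evaluation_apply)
    fix h assume "h \<in> evals X" and le: "le_on (OH X) h F"
    then obtain \<phi> where \<phi>: "\<phi> \<in> CX X" "h = evaluation X \<phi>" by blast
    then have "\<phi> \<in> ?\<Phi>" using le by (auto simp: topspace_OH evaluation_apply)
    from bspec[OF B(3) this] obtain \<psi> where \<psi>: "\<psi> \<in> B" "\<forall>z\<in>J. \<phi> (c \<phi> z) \<le> \<psi> (c \<psi> z) + e"
      by (rule bexE)
    have "T \<psi> \<in> CX X" using T \<psi>(1) B(2) by blast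
    then have "h \<nu> \<le> evaluation X (T \<psi>) \<nu> + e0" if "\<nu> \<in> topspace (OH X)" for \<nu>
      using that OH_set_le_add[of \<nu> X \<phi> "T \<psi>" e0] le_T[OF \<open>\<phi> \<in> ?\<Phi>\<close> \<psi>(2)] \<phi>
      by (simp add: topspace_OH evaluation_apply)
    then show "\<exists>k\<in>(\<lambda>\<phi>. evaluation X (T \<phi>)) ` B. \<forall>\<nu>\<in>topspace (OH X). h \<nu> \<le> k \<nu> + e0"
      using \<psi>(1) by blast
  qed
qed

text \<open>A negated evaluation is in general not an evaluation, but it is the evaluation at
  \<open>neg_fn X \<phi>\<close> preceded by the involution of \<open>OH X\<close>. Transporting
  \<open>F\<close> along this involution reduces the claim to \<open>evals X\<close>.\<close>

lemma finitely_dominated_neg_evals: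
  assumes F: "F \<in> CX (OH X)"
  shows "finitely_dominated (OH X) (neg_fn (OH X) ` evals X) F"
  unfolding finitely_dominated_def
proof (intro allI impI)
  fix e :: real assume e: "0 < e"
  let ?Y = "OH X"
  define pull where "pull f = (\<lambda>\<nu>\<in>topspace ?Y. f (conj_fun X \<nu>))" for f :: "(('a \<Rightarrow> real) \<Rightarrow> real) \<Rightarrow> real"
  have pull_apply: "pull f \<nu> = f (conj_fun X \<nu>)" if "\<nu> \<in> OH_set X" for f \<nu>
    using that by (simp add: pull_def topspace_OH)
  have conj: "conj_fun X \<nu> \<in> topspace ?Y" if "\<nu> \<in> topspace ?Y" for \<nu>
    using that by (simp add: topspace_OH conj_fun_OH_set)
  have pullC: "pull F \<in> CX ?Y"
    unfolding pull_def
    by (intro restrict_in_CX continuous_map_compose[OF continuous_map_conj_fun[OF compact_X nonempty_X], unfolded o_def] CX_continuous[OF F])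
  have pull_eval: "pull (evaluation X \<phi>) = neg_fn ?Y (evaluation X (neg_fn X \<phi>))" if "\<phi> \<in> CX X" for \<phi>
    using that unfolding pull_def neg_fn_def[of ?Y]
    by (intro restrict_ext) (simp add: topspace_OH evaluation_apply conj_fun_OH_set conj_fun_apply)
  have img: "neg_fn ?Y ` evals X = pull ` evals X"
  proof
    show "neg_fn ?Y ` evals X \<subseteq> pull ` evals X"
    proof safe
      fix \<phi> assume \<phi>: "\<phi> \<in> CX X"
      have "neg_fn ?Y (evaluation X \<phi>) = pull (evaluation X (neg_fn X \<phi>))"
        using pull_eval[OF neg_fn_CX[OF \<phi>]] \<phi> by simp
      then show "neg_fn ?Y (evaluation X \<phi>) \<in> pull ` evals X" using neg_fn_CX[OF \<phi>] by blast
    qed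
    show "pull ` evals X \<subseteq> neg_fn ?Y ` evals X"
    proof safe
      fix \<phi> assume "\<phi> \<in> CX X"
      then show "pull (evaluation X \<phi>) \<in> neg_fn ?Y ` evals X"
        unfolding pull_eval[OF \<open>\<phi> \<in> CX X\<close>] by (intro imageI neg_fn_CX)
    qed
  qed
  have le_pull: "le_on ?Y (pull h) k \<longleftrightarrow> le_on ?Y h (pull k)" for h k
  proof -
    have inv: "conj_fun X (conj_fun X \<nu>) = \<nu>" if "\<nu> \<in> topspace ?Y" for \<nu>
      using that by (simp add: topspace_OH conj_fun_conj_fun)
    show ?thesis
    proof (intro iffI ballI)
      fix \<nu> assume "le_on ?Y (pull h) k" and \<nu>: "\<nu> \<in> topspace ?Y"
      from bspec[OF this(1) conj[OF \<nu>]] show "h \<nu> \<le> pull k \<nu>"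
        using \<nu> conj[OF \<nu>] inv[OF \<nu>] by (simp add: pull_def)
    next
      fix \<nu> assume "le_on ?Y h (pull k)" and \<nu>: "\<nu> \<in> topspace ?Y"
      from bspec[OF this(1) conj[OF \<nu>]] show "pull h \<nu> \<le> k \<nu>"
        using \<nu> conj[OF \<nu>] inv[OF \<nu>] by (simp add: pull_def)
    qed
  qed
  obtain B where B: "finite B" "B \<subseteq> {h \<in> evals X. le_on ?Y h (pull F)}"
    "\<forall>h\<in>evals X. le_on ?Y h (pull F) \<longrightarrow> (\<exists>k\<in>B. \<forall>y\<in>topspace ?Y. h y \<le> k y + e)"
    using finitely_dominated_evals[OF pullC, unfolded finitely_dominated_def, THEN spec, THEN mp, OF e]
    by (elim exE conjE)
  show "\<exists>B. finite B \<and> B \<subseteq> {h \<in> neg_fn ?Y ` evals X. le_on ?Y h F} \<and>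
     (\<forall>h\<in>neg_fn ?Y ` evals X. le_on ?Y h F \<longrightarrow> (\<exists>k\<in>B. \<forall>y\<in>topspace ?Y. h y \<le> k y + e))"
    unfolding img
  proof (intro exI[of _ "pull ` B"] conjI ballI impI)
    show "finite (pull ` B)" using B(1) by simp
    show "pull ` B \<subseteq> {h \<in> pull ` evals X. le_on ?Y h F}"
    proof
      fix h assume "h \<in> pull ` B"
      then obtain k where k: "h = pull k" "k \<in> B" by blast
      then have "k \<in> evals X" "le_on ?Y k (pull F)" using B(2) by blast+
      then show "h \<in> {h \<in> pull ` evals X. le_on ?Y h F}" using le_pull k by blast
    qed
    fix h assume "h \<in> pull ` evals X" "le_on ?Y h F"
    then obtain k where k: "k \<in> evals X" "h = pull k" "le_on ?Y k (pull F)" using le_pull by blast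
    from bspec[OF B(3) k(1), THEN mp, OF k(3)]
    obtain l where l: "l \<in> B" "\<forall>y\<in>topspace ?Y. k y \<le> l y + e" by (rule bexE)
    have "\<forall>y\<in>topspace ?Y. h y \<le> pull l y + e"
      using l(2) conj unfolding k(2) by (simp add: pull_def)
    with l(1) show "\<exists>k\<in>pull ` B. \<forall>y\<in>topspace ?Y. h y \<le> k y + e" by (intro bexI[of _ "pull l"] imageI)
  qed
qed

lemma affine_cone_span: "E \<subseteq> CX (OH X) \<Longrightarrow> affine_cone (OH X) (ray_span X E)"
  unfolding ray_span_def
  by (intro affine_cone_Un_UN affine_cone_evals affine_cone_ray) auto

lemma continuous_map_ext_span:
  assumes E: "finite E" "E \<subseteq> CX (OH X)" and F: "F \<in> CX (OH X)"
  shows "continuous_map (OH (OH X)) euclideanreal (\<lambda>M. lower_ext (OH X) (ray_span X E) M F)"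
    and "continuous_map (OH (OH X)) euclideanreal (\<lambda>M. upper_ext (OH X) (ray_span X E) M F)"
proof -
  show "continuous_map (OH (OH X)) euclideanreal (\<lambda>M. lower_ext (OH X) (ray_span X E) M F)"
  proof (rule continuous_map_lower_ext[OF compact_OH nonempty_OH affine_cone_span[OF E(2)] F])
    show "finitely_dominated (OH X) (ray_span X E) F"
      unfolding ray_span_def
      by (rule finitely_dominated_UN_ray[OF compact_OH nonempty_OH F
            finitely_dominated_evals[OF F] E(1)]) (use E(2) in blast)
  qed
  show "continuous_map (OH (OH X)) euclideanreal (\<lambda>M. upper_ext (OH X) (ray_span X E) M F)"
  proof (rule continuous_map_upper_ext[OF compact_OH nonempty_OH affine_cone_span[OF E(2)] F])
    show "finitely_dominated (OH X) (neg_fn (OH X) ` ray_span X E) (neg_fn (OH X) F)"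
      unfolding neg_fn_span
      by (rule finitely_dominated_UN_ray[OF compact_OH nonempty_OH neg_fn_CX[OF F]
            finitely_dominated_neg_evals[OF neg_fn_CX[OF F]] E(1)]) (use E(2) neg_fn_CX in blast)
  qed
qed

section \<open>Extreme functionals and infinite sets of extreme points\<close>

lemma greatest_functional:
  obtains m where "m \<in> OH_set X" "\<And>\<nu> \<phi>. \<lbrakk>\<nu> \<in> OH_set X; \<phi> \<in> CX X\<rbrakk> \<Longrightarrow> \<nu> \<phi> \<le> m \<phi>"
proof -
  \<comment> \<open>The maximum functional. All evaluations attain their maximum at this one point
    of \<open>OH X\<close>; its image under the involution does the same for minima.\<close>
  define m where "m = (\<lambda>\<phi>\<in>CX X. SUP x\<in>topspace X. \<phi> x)"
  have m_eq: "m \<phi> = \<phi> p" if "\<phi> \<in> CX X" "p \<in> topspace X" "\<And>x. x \<in> topspace X \<Longrightarrow> \<phi> x \<le> \<phi> p" for \<phi> p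
    unfolding m_def using that by (auto intro!: cSup_eq_maximum)
  have ge: "\<phi> x \<le> m \<phi>" if "\<phi> \<in> CX X" "x \<in> topspace X" for \<phi> x
    by (rule CX_attains_sup[OF compact_X nonempty_X that(1)]) (metis m_eq that)
  have m: "m \<in> OH_set X"
    unfolding OH_set_iff
  proof (intro conjI ballI allI impI)
    show "m \<in> extensional (CX X)" by (simp add: m_def)
    fix f and a b :: real assume f: "f \<in> CX X" and a: "0 \<le> a"
    obtain p where p: "p \<in> topspace X" "\<And>x. x \<in> topspace X \<Longrightarrow> f x \<le> f p"
      by (rule CX_attains_sup[OF compact_X nonempty_X f]) blast
    have "m (affine_fn X a b f) = affine_fn X a b f p"
      by (rule m_eq) (use p a in \<open>auto simp: affine_fn_CX[OF f] intro: mult_left_mono\<close>)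
    then show "m (affine_fn X a b f) = a * m f + b" using m_eq[OF f p] p(1) by simp
  next
    fix f g assume fg: "f \<in> CX X" "g \<in> CX X" "le_on X f g"
    obtain p where p: "p \<in> topspace X" "\<And>x. x \<in> topspace X \<Longrightarrow> f x \<le> f p"
      by (rule CX_attains_sup[OF compact_X nonempty_X fg(1)]) blast
    have "m f = f p" by (rule m_eq[OF fg(1) p])
    also have "\<dots> \<le> g p" using fg(3) p(1) by blast
    also have "\<dots> \<le> m g" by (rule ge[OF fg(2) p(1)])
    finally show "m f \<le> m g" .
  qed
  show thesis
  proof (rule that[OF m])
    fix \<nu> \<phi> assume "\<nu> \<in> OH_set X" "\<phi> \<in> CX X"
    then show "\<nu> \<phi> \<le> m \<phi>" by (rule OH_set_le_const) (rule ge[OF \<open>\<phi> \<in> CX X\<close>])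
  qed
qed

lemma OH_intermediate_value:
  assumes e: "e \<in> CX (OH X)" and \<nu>: "\<nu> \<in> OH_set X" "\<nu>' \<in> OH_set X" and v: "e \<nu> \<le> v" "v \<le> e \<nu>'"
  obtains \<omega> where "\<omega> \<in> OH_set X" "e \<omega> = v"
proof -
  let ?c = "\<lambda>t. mix X t \<nu> \<nu>'"
  have "continuous_map (top_of_set {0..1}) (OH X) ?c"
  proof (rule continuous_map_into_OH[OF compact_X nonempty_X])
    show "?c t \<in> OH_set X" if "t \<in> topspace (top_of_set {0..1})" for t
      using that \<nu> by (auto intro: mix_OH_set)
    show "continuous_map (top_of_set {0..1}) euclideanreal (\<lambda>t. ?c t f)" if "f \<in> CX X" for f
      unfolding mix_def using that by (auto intro!: continuous_intros)
  qed
  from continuous_map_compose[OF this CX_continuous[OF e]]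
  have "continuous_on {0..1} (\<lambda>t. e (?c t))" by (simp add: o_def)
  moreover have "?c 0 = \<nu>" "?c 1 = \<nu>'"
    using \<nu>(1,2)[THEN OH_set_extensional] by (auto simp: mix_def extensional_def)
  ultimately obtain t where "0 \<le> t" "t \<le> 1" "e (?c t) = v"
    using IVT'[of "\<lambda>t. e (?c t)" 0 v 1] v by auto
  then show thesis using that mix_OH_set[OF \<nu>] by blast
qed

lemma infinite_between:
  assumes e: "e \<in> CX (OH X)" and \<nu>: "\<nu> \<in> OH_set X" "\<nu>' \<in> OH_set X"
    and ab: "e \<nu> \<le> a" "a < b" "b \<le> e \<nu>'"
  shows "infinite {\<omega> \<in> OH_set X. a \<le> e \<omega> \<and> e \<omega> \<le> b}"
proof -
  have "{a..b} \<subseteq> e ` {\<omega> \<in> OH_set X. a \<le> e \<omega> \<and> e \<omega> \<le> b}"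
  proof
    fix v assume v: "v \<in> {a..b}"
    then have "e \<nu> \<le> v" "v \<le> e \<nu>'" using ab by auto
    then obtain \<omega> where "\<omega> \<in> OH_set X" "e \<omega> = v" by (rule OH_intermediate_value[OF e \<nu>])
    then show "v \<in> e ` {\<omega> \<in> OH_set X. a \<le> e \<omega> \<and> e \<omega> \<le> b}" using v by auto
  qed
  then show ?thesis using infinite_Icc[OF ab(2)] by (meson finite_imageI finite_subset)
qed

text \<open>Clipping makes all points with \<open>e \<le> 0\<close> minimal and all with
  \<open>1 \<le> e\<close> maximal. The strict inequalities leave a nondegenerate interval of values
  on either side, and by convexity of \<open>OH X\<close> each of these values is attained.\<close>

lemma extremes_infinite_clip:
  assumes e: "continuous_map (OH X) euclideanreal e" and \<nu>: "\<nu> \<in> OH_set X" "\<nu>' \<in> OH_set X"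
    and "e \<nu> < 0" "1 < e \<nu>'"
  shows "extremes_infinite (OH X) (clip (OH X) e)"
proof -
  let ?e = "restrict e (OH_set X)"
  have e': "?e \<in> CX (OH X)" using restrict_in_CX[OF e] by (simp add: topspace_OH)
  have "infinite {\<omega> \<in> OH_set X. ?e \<nu> \<le> ?e \<omega> \<and> ?e \<omega> \<le> 0}"
    using assms by (intro infinite_between[OF e' \<nu>]) auto
  then have "infinite {p \<in> topspace (OH X). \<forall>y\<in>topspace (OH X). clip (OH X) e p \<le> clip (OH X) e y}"
    by (rule contrapos_nn) (erule finite_subset[rotated], auto simp: topspace_OH clip_apply)
  moreover have "infinite {\<omega> \<in> OH_set X. 1 \<le> ?e \<omega> \<and> ?e \<omega> \<le> ?e \<nu>'}"
    using assms by (intro infinite_between[OF e' \<nu>]) auto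
  then have "infinite {p \<in> topspace (OH X). \<forall>y\<in>topspace (OH X). clip (OH X) e y \<le> clip (OH X) e p}"
    by (rule contrapos_nn) (erule finite_subset[rotated], auto simp: topspace_OH clip_apply)
  ultimately show ?thesis by (simp add: extremes_infinite_def)
qed

section \<open>The multiplication map\<close>

lemma mu_OH_in_OH_set:
  assumes M: "M \<in> OH_set (OH X)" shows "mu_OH X M \<in> OH_set X"
  unfolding OH_set_iff
proof (intro conjI ballI allI impI)
  show "mu_OH X M \<in> extensional (CX X)" by (simp add: mu_OH_def)
  fix f and a b :: real assume "f \<in> CX X" "0 \<le> a"
  then show "mu_OH X M (affine_fn X a b f) = a * mu_OH X M f + b"
    using OH_set_affine[OF M evaluation_CX] by (simp add: mu_OH_def affine_fn_CX flip: affine_fn_evaluation)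
next
  fix f g assume fg: "f \<in> CX X" "g \<in> CX X" "le_on X f g"
  have "M (evaluation X f) \<le> M (evaluation X g)"
    by (rule OH_set_mono[OF M evaluation_CX[OF fg(1)] evaluation_CX[OF fg(2)]])
      (use fg in \<open>simp add: topspace_OH evaluation_apply OH_set_mono\<close>)
  then show "mu_OH X M f \<le> mu_OH X M g" using fg by (simp add: mu_OH_def)
qed

lemma continuous_map_mu_OH: "continuous_map (OH (OH X)) (OH X) (mu_OH X)"
proof (rule continuous_map_into_OH[OF compact_X nonempty_X])
  show "mu_OH X M \<in> OH_set X" if "M \<in> topspace (OH (OH X))" for M
    using that mu_OH_in_OH_set by (simp add: OH_eq(2)[OF compact_OH nonempty_OH])
  show "continuous_map (OH (OH X)) euclideanreal (\<lambda>M. mu_OH X M \<phi>)" if "\<phi> \<in> CX X" for \<phi>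
    using continuous_map_OH_eval[OF compact_OH nonempty_OH evaluation_CX[OF that]] that by (simp add: mu_OH_def)
qed

lemma span_cong:
  assumes M: "M \<in> OH_set (OH X)" "M' \<in> OH_set (OH X)" and mu: "mu_OH X M = mu_OH X M'"
    and E: "\<And>d. d \<in> E \<Longrightarrow> d \<in> CX (OH X)" "\<And>d. d \<in> E \<Longrightarrow> M d = M' d" and h: "h \<in> ray_span X E"
  shows "M h = M' h"
proof -
  consider "h \<in> evals X" | d where "d \<in> E" "h \<in> affine_ray (OH X) d"
    using h unfolding ray_span_def by blast
  then show ?thesis
  proof cases
    case 1
    then obtain \<phi> where \<phi>: "\<phi> \<in> CX X" "h = evaluation X \<phi>" by blast
    then show ?thesis using fun_cong[OF mu, of \<phi>] by (simp add: mu_OH_def)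
  next
    case 2
    show ?thesis by (rule affine_ray_cong[OF M E(1)[OF 2(1)] E(2)[OF 2(1)] 2(2)])
  qed
qed
end

section \<open>Choice of the coordinate functions\<close>

lemma OH_set_close:
  assumes "M \<in> OH_set Y" "f \<in> CX Y" "g \<in> CX Y" "\<And>y. y \<in> topspace Y \<Longrightarrow> \<bar>f y - g y\<bar> \<le> e"
  shows "\<bar>M f - M g\<bar> \<le> e"
proof -
  have "f y \<le> g y + e" "g y \<le> f y + e" if "y \<in> topspace Y" for y using assms(4)[OF that] by linarith+
  then have "M f \<le> M g + e" "M g \<le> M f + e"
    using OH_set_le_add[OF assms(1-3)] OH_set_le_add[OF assms(1,3,2)] by simp_all
  then show ?thesis by linarith
qed

locale separated_compact = nonempty_compact X for X :: "'a topology" +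
  fixes D :: "('a \<Rightarrow> real) set"
  assumes D: "separating X D" "countable D"
    and two_points: "\<exists>x\<in>topspace X. \<exists>y\<in>topspace X. x \<noteq> y"
begin

lemma extreme_functionals:
  obtains m n where "m \<in> OH_set X" "n \<in> OH_set X" "m \<noteq> n"
    "\<And>\<nu> \<phi>. \<lbrakk>\<nu> \<in> OH_set X; \<phi> \<in> CX X\<rbrakk> \<Longrightarrow> \<nu> \<phi> \<le> m \<phi>"
    "\<And>\<nu> \<phi>. \<lbrakk>\<nu> \<in> OH_set X; \<phi> \<in> CX X\<rbrakk> \<Longrightarrow> n \<phi> \<le> \<nu> \<phi>"
proof -
  obtain m where m: "m \<in> OH_set X" "\<And>\<nu> \<phi>. \<lbrakk>\<nu> \<in> OH_set X; \<phi> \<in> CX X\<rbrakk> \<Longrightarrow> \<nu> \<phi> \<le> m \<phi>"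
    by (rule greatest_functional) blast
  define n where "n = conj_fun X m"
  have n: "n \<in> OH_set X" unfolding n_def by (rule conj_fun_OH_set[OF m(1)])
  have le: "n \<phi> \<le> \<nu> \<phi>" if "\<nu> \<in> OH_set X" "\<phi> \<in> CX X" for \<nu> \<phi>
    using m(2)[OF conj_fun_OH_set[OF that(1)] neg_fn_CX[OF that(2)]] that(2)
    by (simp add: n_def conj_fun_apply neg_fn_CX)
  obtain x y where xy: "x \<in> topspace X" "y \<in> topspace X" "x \<noteq> y" using two_points by blast
  obtain g where g: "g \<in> CX X" "g x \<noteq> g y" using D(1) xy unfolding separating_def by blast
  have "n g \<le> g x" "n g \<le> g y" "g x \<le> m g" "g y \<le> m g"
    using le[OF dirac_OH_set g(1)] m(2)[OF dirac_OH_set g(1)] xy g(1) by fastforce+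
  then have "m \<noteq> n" using g(2) by auto
  from m(1) n this show thesis by (rule that) (erule (1) m(2), erule (1) le)
qed

lemma infinite_OH_set: "infinite (OH_set X)"
proof -
  obtain m n where mn: "m \<in> OH_set X" "n \<in> OH_set X" "m \<noteq> n"
    "\<And>\<nu> \<phi>. \<lbrakk>\<nu> \<in> OH_set X; \<phi> \<in> CX X\<rbrakk> \<Longrightarrow> \<nu> \<phi> \<le> m \<phi>"
    by (rule extreme_functionals) blast
  obtain \<phi> where \<phi>: "\<phi> \<in> CX X" "m \<phi> \<noteq> n \<phi>" using OH_set_eqI[OF mn(1,2)] mn(3) by blast
  have "n \<phi> < m \<phi>" using mn(4)[OF mn(2) \<phi>(1)] \<phi>(2) by simp
  then have "infinite {\<omega> \<in> OH_set X. n \<phi> \<le> evaluation X \<phi> \<omega> \<and> evaluation X \<phi> \<omega> \<le> m \<phi>}"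
    using mn(1,2) \<phi> by (intro infinite_between[of _ n m])
      (auto simp: evaluation_CX evaluation_apply)
  then show ?thesis by (rule contrapos_nn) (erule finite_subset[rotated], auto)
qed

text \<open>A given function may have too few extreme points for
  \<open>free_function_exists\<close>. Cutting off its top and bottom by at most
  \<open>\<epsilon>\<close> cures this. The affine change does no harm, as the value of a functional
  at \<open>f\<close> determines that at \<open>a * f + b\<close>.\<close>

lemma approximation_extremes_infinite:
  assumes e: "e \<in> CX (OH X)" and \<epsilon>: "0 < \<epsilon>"
  shows "\<exists>f. f \<in> CX (OH X) \<and> extremes_infinite (OH X) f
    \<and> (\<exists>a b. 0 \<le> a \<and> (\<forall>\<nu>\<in>topspace (OH X). \<bar>a * f \<nu> + b - e \<nu>\<bar> \<le> \<epsilon>))"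
proof -
  obtain p where p: "p \<in> topspace (OH X)" "\<And>y. y \<in> topspace (OH X) \<Longrightarrow> e y \<le> e p"
    by (rule CX_attains_sup[OF compact_OH nonempty_OH e]) blast
  obtain q where q: "q \<in> topspace (OH X)" "\<And>y. y \<in> topspace (OH X) \<Longrightarrow> e q \<le> e y"
    by (rule CX_attains_inf[OF compact_OH nonempty_OH e]) blast
  show ?thesis
  proof (cases "e p = e q")
    case True
    let ?f = "const_fn (OH X) 0"
    have "{p \<in> topspace (OH X). \<forall>y\<in>topspace (OH X). ?f y \<le> ?f p} = OH_set X"
      "{p \<in> topspace (OH X). \<forall>y\<in>topspace (OH X). ?f p \<le> ?f y} = OH_set X"
      by (auto simp: topspace_OH[symmetric])
    then have "extremes_infinite (OH X) ?f" using infinite_OH_set by (simp add: extremes_infinite_def)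
    moreover have "\<bar>0 * ?f \<nu> + e p - e \<nu>\<bar> \<le> \<epsilon>" if "\<nu> \<in> topspace (OH X)" for \<nu>
      using p(2)[OF that] q(2)[OF that] True \<epsilon> by simp
    ultimately show ?thesis
      by (intro exI[of _ ?f] conjI exI[of _ 0] exI[of _ "e p"] ballI) (simp_all add: const_fn_CX)
  next
    case False
    \<comment> \<open>At most a third of the oscillation, so that a positive length \<open>a\<close>
      remains after cutting off \<open>\<delta>\<close> at both ends.\<close>
    define \<delta> where "\<delta> = min \<epsilon> ((e p - e q) / 3)"
    have lt: "e q < e p" using False p(2)[OF q(1)] by simp
    have \<delta>: "0 < \<delta>" "\<delta> \<le> \<epsilon>" "3 * \<delta> \<le> e p - e q" using lt \<epsilon> by (auto simp: \<delta>_def min_def field_simps)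
    define a where "a = e p - e q - 2 * \<delta>"
    define b where "b = e q + \<delta>"
    have a: "0 < a" using \<delta> by (simp add: a_def)
    define u where "u \<nu> = (e \<nu> - b) / a" for \<nu>
    have u: "continuous_map (OH X) euclideanreal u"
      unfolding u_def using a by (intro continuous_intros CX_continuous[OF e]) auto
    have eu: "e \<nu> = a * u \<nu> + b" for \<nu> using a by (simp add: u_def)
    have "u q < 0" "1 < u p" using \<delta> a by (simp_all add: u_def a_def b_def field_simps)
    then have "extremes_infinite (OH X) (clip (OH X) u)"
      using p(1) q(1) by (intro extremes_infinite_clip[OF u]) (auto simp: topspace_OH)
    moreover have "\<bar>a * clip (OH X) u \<nu> + b - e \<nu>\<bar> \<le> \<epsilon>" if \<nu>: "\<nu> \<in> topspace (OH X)" for \<nu>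
    proof -
      have lo: "- \<delta> \<le> a * u \<nu>" and hi: "a * u \<nu> \<le> a + \<delta>"
        using p(2)[OF \<nu>] q(2)[OF \<nu>] unfolding eu[of \<nu>] by (simp_all add: a_def b_def)
      have "\<bar>a * max 0 (min 1 (u \<nu>)) - a * u \<nu>\<bar> \<le> \<delta>"
      proof -
        consider "u \<nu> < 0" | "1 < u \<nu>" | "0 \<le> u \<nu>" "u \<nu> \<le> 1" by linarith
        then show ?thesis
        proof cases
          case 1 then show ?thesis using lo a mult_pos_neg[of a "u \<nu>"] by simp
        next
          case 2
          then have "a * 1 \<le> a * u \<nu>" using a by (intro mult_left_mono) auto
          then show ?thesis using hi 2 by simp
        next
          case 3 then show ?thesis using \<delta> by simp
        qed
      qed
      then show ?thesis using \<delta>(2) \<nu> unfolding eu[of \<nu>] by (simp add: clip_apply)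
    qed
    ultimately show ?thesis
      using a by (intro exI[of _ "clip (OH X) u"] conjI exI[of _ a] exI[of _ b] ballI)
        (simp_all add: clip_CX u clip_apply)
  qed
qed

text \<open>Infinitely many extreme points allow a new maximum point to avoid the finite set
  \<open>B\<close> and a new minimum point to avoid \<open>A\<close>. The initial points
  \<open>m\<close> and \<open>n\<close> will serve the evaluations.\<close>

lemma disjoint_extreme_points:
  assumes "finite E" "\<forall>h\<in>E. extremes_infinite Y h"
    and "m \<in> topspace Y" "n \<in> topspace Y" "m \<noteq> n"
  shows "\<exists>A B. finite A \<and> finite B \<and> A \<subseteq> topspace Y \<and> B \<subseteq> topspace Y \<and> A \<inter> B = {} \<and> m \<in> A \<and> n \<in> B
    \<and> (\<forall>h\<in>E. (\<exists>p\<in>A. \<forall>y\<in>topspace Y. h y \<le> h p) \<and> (\<exists>p\<in>B. \<forall>y\<in>topspace Y. h p \<le> h y))"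
  using assms(1,2)
proof (induction E rule: finite_induct)
  case empty
  show ?case using assms(3-5) by (intro exI[of _ "{m}"] exI[of _ "{n}"]) auto
next
  case (insert h E)
  then have "\<exists>A B. finite A \<and> finite B \<and> A \<subseteq> topspace Y \<and> B \<subseteq> topspace Y \<and> A \<inter> B = {} \<and> m \<in> A \<and> n \<in> B
    \<and> (\<forall>h\<in>E. (\<exists>p\<in>A. \<forall>y\<in>topspace Y. h y \<le> h p) \<and> (\<exists>p\<in>B. \<forall>y\<in>topspace Y. h p \<le> h y))"
    by simp
  then obtain A B where AB: "finite A" "finite B" "A \<subseteq> topspace Y" "B \<subseteq> topspace Y" "A \<inter> B = {}" "m \<in> A" "n \<in> B"
    and max: "\<forall>h\<in>E. (\<exists>p\<in>A. \<forall>y\<in>topspace Y. h y \<le> h p) \<and> (\<exists>p\<in>B. \<forall>y\<in>topspace Y. h p \<le> h y)"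
    by (elim exE conjE)
  have inf: "infinite {p \<in> topspace Y. \<forall>y\<in>topspace Y. h y \<le> h p}"
    "infinite {p \<in> topspace Y. \<forall>y\<in>topspace Y. h p \<le> h y}"
    using insert.prems by (simp_all add: extremes_infinite_def)
  have "{p \<in> topspace Y. \<forall>y\<in>topspace Y. h y \<le> h p} - B \<noteq> {}"
    using infinite_imp_nonempty[OF Diff_infinite_finite[OF AB(2) inf(1)]] .
  then obtain p where p: "p \<in> topspace Y" "\<forall>y\<in>topspace Y. h y \<le> h p" "p \<notin> B" by auto
  have "{p \<in> topspace Y. \<forall>y\<in>topspace Y. h p \<le> h y} - insert p A \<noteq> {}"
    using infinite_imp_nonempty[OF Diff_infinite_finite[OF _ inf(2)], of "insert p A"] AB(1) by simp
  then obtain q where q: "q \<in> topspace Y" "\<forall>y\<in>topspace Y. h q \<le> h y" "q \<notin> A" "q \<noteq> p" by auto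
  show ?case
  proof (rule exI[of _ "insert p A"], rule exI[of _ "insert q B"], intro conjI ballI)
    show "insert p A \<inter> insert q B = {}" using AB(5) p(3) q(3,4) by auto
    fix k assume "k \<in> insert h E"
    then consider "k = h" | "k \<in> E" by blast
    then show "\<exists>p\<in>insert p A. \<forall>y\<in>topspace Y. k y \<le> k p"
    proof cases
      case 1 then show ?thesis using p(2) by blast
    next
      case 2 then show ?thesis using bspec[OF max 2] by (elim conjE bexE) (rule bexI, assumption, simp)
    qed
    show "\<exists>p\<in>insert q B. \<forall>y\<in>topspace Y. k p \<le> k y"
    proof (cases "k = h")
      case True then show ?thesis using q(2) by blast
    next
      case False
      then have "k \<in> E" using \<open>k \<in> insert h E\<close> by blast
      then show ?thesis using bspec[OF max \<open>k \<in> E\<close>] by (elim conjE bexE) (rule bexI, assumption, simp)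
    qed
  qed (use AB p(1) q(1) in auto)
qed

lemma free_function_exists:
  assumes E: "finite E" "E \<subseteq> CX (OH X)" "\<And>h. h \<in> E \<Longrightarrow> extremes_infinite (OH X) h"
  shows "\<exists>g. g \<in> CX (OH X) \<and> extremes_infinite (OH X) g \<and> (\<forall>\<nu>\<in>topspace (OH X). 0 \<le> g \<nu> \<and> g \<nu> \<le> 1)
    \<and> free_for (OH X) (ray_span X E) g"
proof -
  let ?Y = "OH X"
  obtain m n where mn: "m \<in> OH_set X" "n \<in> OH_set X" "m \<noteq> n"
    "\<And>\<nu> \<phi>. \<lbrakk>\<nu> \<in> OH_set X; \<phi> \<in> CX X\<rbrakk> \<Longrightarrow> \<nu> \<phi> \<le> m \<phi>"
    "\<And>\<nu> \<phi>. \<lbrakk>\<nu> \<in> OH_set X; \<phi> \<in> CX X\<rbrakk> \<Longrightarrow> n \<phi> \<le> \<nu> \<phi>"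
    by (rule extreme_functionals) blast
  have mn': "m \<in> topspace ?Y" "n \<in> topspace ?Y" using mn by (simp_all add: topspace_OH)
  have extremes: "\<forall>h\<in>E. extremes_infinite ?Y h" using E(3) by blast
  obtain A B where AB: "finite A" "finite B" "A \<subseteq> topspace ?Y" "B \<subseteq> topspace ?Y" "A \<inter> B = {}" "m \<in> A" "n \<in> B"
    and max: "\<forall>h\<in>E. (\<exists>p\<in>A. \<forall>y\<in>topspace ?Y. h y \<le> h p) \<and> (\<exists>p\<in>B. \<forall>y\<in>topspace ?Y. h p \<le> h y)"
    using disjoint_extreme_points[OF E(1) extremes mn' mn(3)] by (elim exE conjE)
  have T2: "Hausdorff_space ?Y" by (rule OH_eq(4)[OF compact_X nonempty_X])
  have normal: "normal_space ?Y"
    using compact_OH T2 by (simp add: compact_Hausdorff_or_regular_imp_normal_space)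
  have closed: "closedin ?Y A" "closedin ?Y B"
    using T2 AB(1-4) by (auto intro!: compactin_imp_closedin finite_imp_compactin)
  \<comment> \<open>The values -1 and 2 overshoot \<open>[0,1]\<close> on both sides: after
    clipping, the new function again has infinitely many extreme points and can itself be one of the
    earlier functions at later stages.\<close>
  obtain u where u: "continuous_map ?Y (top_of_set {-1..2::real}) u" "u ` A \<subseteq> {-1}" "u ` B \<subseteq> {2}"
    by (rule Urysohn_lemma[OF normal closed, of "-1" 2]) (use AB(5) in \<open>auto simp: disjnt_def\<close>)
  have u': "continuous_map ?Y euclideanreal u" using u(1) by (rule continuous_map_into_fulltopology)
  let ?g = "clip ?Y u"
  have g0: "?g p = 0" "p \<in> topspace ?Y" if "p \<in> A" for p
  proof -
    show "p \<in> topspace ?Y" using that AB(3) by blast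
    have "u p = -1" using u(2) that by blast
    then show "?g p = 0" using \<open>p \<in> topspace ?Y\<close> by (simp add: clip_apply)
  qed
  have g1: "?g p = 1" "p \<in> topspace ?Y" if "p \<in> B" for p
  proof -
    show "p \<in> topspace ?Y" using that AB(4) by blast
    have "u p = 2" using u(3) that by blast
    then show "?g p = 1" using \<open>p \<in> topspace ?Y\<close> by (simp add: clip_apply)
  qed
  have "u m = -1" "u n = 2" using u(2,3) AB(6,7) by blast+
  then have "extremes_infinite ?Y ?g"
    by (intro extremes_infinite_clip[OF u' mn(1,2)]) simp_all
  moreover have "free_for ?Y (ray_span X E) ?g"
    unfolding free_for_def
  proof
    fix h assume "h \<in> ray_span X E"
    then consider "h \<in> evals X" | d where "d \<in> E" "h \<in> affine_ray ?Y d" unfolding ray_span_def by blast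
    then show "(\<exists>p\<in>topspace ?Y. (\<forall>y\<in>topspace ?Y. h y \<le> h p) \<and> ?g p \<le> 0) \<and>
      (\<exists>p\<in>topspace ?Y. (\<forall>y\<in>topspace ?Y. h p \<le> h y) \<and> 1 \<le> ?g p)"
    proof cases
      case 1
      then obtain \<phi> where \<phi>: "\<phi> \<in> CX X" "h = evaluation X \<phi>" by blast
      have "\<forall>y\<in>topspace ?Y. h y \<le> h m" "\<forall>y\<in>topspace ?Y. h n \<le> h y"
        using mn(1,2) mn(4,5)[OF _ \<phi>(1)] by (simp_all add: \<phi>(2) topspace_OH evaluation_apply)
      with mn' g0(1)[OF AB(6)] g1(1)[OF AB(7)] show ?thesis
        by (intro conjI bexI[OF _ mn'(1)] bexI[OF _ mn'(2)]) simp_all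
    next
      case 2
      obtain p q where p: "p \<in> A" "\<forall>y\<in>topspace ?Y. d y \<le> d p" and q: "q \<in> B" "\<forall>y\<in>topspace ?Y. d q \<le> d y"
        using bspec[OF max 2(1)] by (elim conjE bexE)
      have "free_for ?Y {d} ?g"
        unfolding free_for_def
        using p(2) q(2) g0[OF p(1)] g1[OF q(1)]
        by (intro ballI conjI bexI[OF _ g0(2)[OF p(1)]] bexI[OF _ g1(2)[OF q(1)]]) simp_all
      from bspec[OF free_for_ray[OF this, unfolded free_for_def] 2(2)] show ?thesis .
    qed
  qed
  ultimately show ?thesis
    by (intro exI[of _ ?g] conjI) (simp_all add: clip_CX[OF u'] clip_apply)
qed

lemma coordinate_functions:
  obtains f g where
    "\<And>n. f n \<in> CX (OH X)"
    "\<And>M M'. \<lbrakk>M \<in> OH_set (OH X); M' \<in> OH_set (OH X); \<And>n. M (f n) = M' (f n)\<rbrakk> \<Longrightarrow> M = M'"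
    "\<And>n. g n \<in> CX (OH X)" "\<And>n \<nu>. \<nu> \<in> topspace (OH X) \<Longrightarrow> 0 \<le> g n \<nu> \<and> g n \<nu> \<le> 1"
    "\<And>n::nat. free_for (OH X) (ray_span X (f ` {..n} \<union> g ` {..<n})) (g n)"
proof -
  let ?Y = "OH X"
  obtain E0 where E0: "countable E0" "E0 \<subseteq> CX X"
    "\<And>f e. \<lbrakk>f \<in> CX X; 0 < e\<rbrakk> \<Longrightarrow> \<exists>g\<in>E0. \<forall>x\<in>topspace X. \<bar>g x - f x\<bar> \<le> e"
    by (rule countable_dense_CX[OF compact_X D]) blast
  have "separating ?Y (evaluation X ` E0)" "countable (evaluation X ` E0)"
    using separating_evaluations[OF E0(2,3)] E0(1) by simp_all
  then obtain E where E: "countable E" "E \<subseteq> CX ?Y"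
    "\<And>f e. \<lbrakk>f \<in> CX ?Y; 0 < e\<rbrakk> \<Longrightarrow> \<exists>g\<in>E. \<forall>x\<in>topspace ?Y. \<bar>g x - f x\<bar> \<le> e"
    by (rule countable_dense_CX[OF compact_OH]) blast
  have "E \<noteq> {}" using E(3)[OF const_fn_CX[of ?Y 0], of 1] by auto
  \<comment> \<open>The index \<open>n\<close> encodes a member of the dense family together with a
    precision, so each member is approximated arbitrarily well by rescaled
    \<open>f n\<close>.\<close>
  define e where "e n = from_nat_into E (fst (prod_decode n))" for n
  define \<epsilon> where "\<epsilon> n = 1 / real (Suc (snd (prod_decode n)))" for n
  define close where "close n f \<longleftrightarrow> (\<exists>a b. 0 \<le> a \<and> (\<forall>\<nu>\<in>topspace ?Y. \<bar>a * f \<nu> + b - e n \<nu>\<bar> \<le> \<epsilon> n))" for n f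
  have e_CX: "e n \<in> CX ?Y" for n
    using E(2) from_nat_into[OF \<open>E \<noteq> {}\<close>] by (auto simp: e_def)
  have "\<exists>f. f \<in> CX ?Y \<and> extremes_infinite ?Y f \<and> close n f" for n
    unfolding close_def by (rule approximation_extremes_infinite[OF e_CX]) (simp add: \<epsilon>_def)
  then have "\<exists>f. \<forall>n. f n \<in> CX ?Y \<and> extremes_infinite ?Y (f n) \<and> close n (f n)"
    by (intro choice allI)
  then obtain f where "\<forall>n. f n \<in> CX ?Y \<and> extremes_infinite ?Y (f n) \<and> close n (f n)"
    by (rule exE)
  then have f: "\<And>n. f n \<in> CX ?Y" "\<And>n. extremes_infinite ?Y (f n)" "\<And>n. close n (f n)"
    by simp_all
  have determined: "M = M'"
    if M: "M \<in> OH_set ?Y" "M' \<in> OH_set ?Y" and eq: "\<And>n. M (f n) = M' (f n)" for M M'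
  proof (rule OH_set_eqI[OF M])
    fix h assume h: "h \<in> CX ?Y"
    \<comment> \<open>\<open>k\<close> is within \<open>d / 4\<close> of \<open>h\<close>, and the
      rescaled \<open>f n\<close> within \<open>d / 4\<close> of \<open>k\<close>; the two
      functionals then contribute \<open>d / 2\<close> each.\<close>
    have "\<bar>M h - M' h\<bar> \<le> 0 + d" if d: "0 < d" for d
    proof -
      have "0 < d / 4" using d by simp
      from E(3)[OF h this] obtain k where k: "k \<in> E" "\<forall>x\<in>topspace ?Y. \<bar>k x - h x\<bar> \<le> d / 4" by (rule bexE)
      obtain j where j: "1 / real (Suc j) < d / 4" using nat_approx_posE[OF \<open>0 < d / 4\<close>] by blast
      define n where "n = prod_encode (to_nat_on E k, j)"
      have n: "e n = k" "\<epsilon> n = 1 / real (Suc j)"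
        using E(1) k(1) by (simp_all add: n_def e_def \<epsilon>_def)
      obtain a b where ab: "0 \<le> a" "\<forall>\<nu>\<in>topspace ?Y. \<bar>a * f n \<nu> + b - e n \<nu>\<bar> \<le> \<epsilon> n"
        using f(3)[of n] unfolding close_def by (elim exE conjE)
      let ?k = "affine_fn ?Y a b (f n)"
      have near: "\<bar>?k y - h y\<bar> \<le> d / 2" if y: "y \<in> topspace ?Y" for y
      proof -
        have "?k y = a * f n y + b" using y by simp
        then show ?thesis using bspec[OF ab(2) y] bspec[OF k(2) y] j unfolding n by linarith
      qed
      have kC: "?k \<in> CX ?Y" by (rule affine_fn_CX[OF f(1)])
      have "M ?k = M' ?k" using OH_set_affine[OF M(1) f(1) ab(1)] OH_set_affine[OF M(2) f(1) ab(1)] eq by simp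
      then show ?thesis
        using OH_set_close[OF M(1) kC h near] OH_set_close[OF M(2) kC h near] by linarith
    qed
    then have "\<bar>M h - M' h\<bar> \<le> 0" by (rule field_le_epsilon)
    then show "M h = M' h" by simp
  qed
  let ?P = "\<lambda>g n r. r \<in> CX ?Y \<and> extremes_infinite ?Y r \<and> (\<forall>\<nu>\<in>topspace ?Y. 0 \<le> r \<nu> \<and> r \<nu> \<le> 1)
    \<and> free_for ?Y (ray_span X (f ` {..n} \<union> g ` {..<n})) r"
  have "\<exists>g. \<forall>n. ?P g n (g n)"
  \<comment> \<open>Course-of-values recursion: \<open>g n\<close> has to be free with respect to
    all earlier \<open>g m\<close> at once, and to \<open>f n\<close> as well.\<close>
  proof (rule dependent_wellorder_choice)
    fix r and g g' :: "nat \<Rightarrow> (('a \<Rightarrow> real) \<Rightarrow> real) \<Rightarrow> real" and n :: nat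
    assume "\<And>m. m < n \<Longrightarrow> g m = g' m"
    then have "g ` {..<n} = g' ` {..<n}" by (intro image_cong) auto
    then show "?P g n r = ?P g' n r" by simp
  next
    fix n :: nat and g assume "\<And>m. m < n \<Longrightarrow> ?P g m (g m)"
    then have g: "\<And>m. m < n \<Longrightarrow> g m \<in> CX ?Y" "\<And>m. m < n \<Longrightarrow> extremes_infinite ?Y (g m)" by simp_all
    show "\<exists>r. ?P g n r"
    proof (rule free_function_exists)
      show "finite (f ` {..n} \<union> g ` {..<n})" by simp
      show "f ` {..n} \<union> g ` {..<n} \<subseteq> CX ?Y" using f(1) g(1) by auto
      show "extremes_infinite ?Y h" if "h \<in> f ` {..n} \<union> g ` {..<n}" for h using that f(2) g(2) by auto
    qed
  qed
  then obtain g where "\<forall>n. ?P g n (g n)" by (rule exE)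
  then have g: "?P g n (g n)" for n by (rule spec)
  show thesis
  proof (rule that[of f g])
    show "free_for ?Y (ray_span X (f ` {..n} \<union> g ` {..<n})) (g n)" for n using g[of n] by simp
    show "g n \<in> CX ?Y" for n using g[of n] by simp
    show "0 \<le> g n \<nu> \<and> g n \<nu> \<le> 1" if "\<nu> \<in> topspace ?Y" for n \<nu> using g[of n] that by simp
  qed (fact f determined)+
qed

section \<open>The homeomorphism\<close>

lemma Q_fibration_mu_OH:
  "Q_fibration (OH (OH X)) (OH X) (mu_OH X)"
proof -
  let ?Y = "OH X" and ?Z = "OH (OH X)"
  note Y = compact_OH nonempty_OH
  note topY = topspace_OH and topZ = OH_eq(2)[OF Y]
  obtain f g :: "nat \<Rightarrow> (('a \<Rightarrow> real) \<Rightarrow> real) \<Rightarrow> real" where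
    f: "\<And>n. f n \<in> CX ?Y"
    and determined: "\<And>M M'. \<lbrakk>M \<in> OH_set ?Y; M' \<in> OH_set ?Y; \<And>n. M (f n) = M' (f n)\<rbrakk> \<Longrightarrow> M = M'"
    and g: "\<And>n. g n \<in> CX ?Y" "\<And>n \<nu>. \<nu> \<in> topspace ?Y \<Longrightarrow> 0 \<le> g n \<nu> \<and> g n \<nu> \<le> 1"
    and free: "\<And>n::nat. free_for ?Y (ray_span X (f ` {..n} \<union> g ` {..<n})) (g n)"
    by (rule coordinate_functions) blast
  \<comment> \<open>\<open>A n\<close> collects what is known before stage \<open>n\<close>;
    \<open>A' n\<close> also has \<open>f n\<close>, but not yet \<open>g n\<close>, which comes
    last within the stage.\<close>
  define A where "A n = ray_span X (f ` {..<n} \<union> g ` {..<n})" for n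
  define A' where "A' n = ray_span X (f ` {..n} \<union> g ` {..<n})" for n
  have cone: "affine_cone ?Y (A n)" "affine_cone ?Y (A' n)" for n
    unfolding A_def A'_def by (intro affine_cone_span; use f g(1) in auto)+
  have A_sub: "A m \<subseteq> A n" if "m \<le> n" for m n
    unfolding A_def using that by (intro span_mono) auto
  have A_A': "A n \<subseteq> A' n" for n
    unfolding A_def A'_def by (intro span_mono) auto
  have fA': "f n \<in> A' n" for n unfolding A'_def by (rule mem_span[OF _ f]) auto
  have fA: "f m \<in> A n" if "m < n" for m n unfolding A_def by (rule mem_span[OF _ f]) (use that in auto)
  have gA: "g m \<in> A n" if "m < n" for m n unfolding A_def by (rule mem_span[OF _ g(1)]) (use that in auto)
  define L where "L n M = lower_ext ?Y (A n) M (f n)" for n M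
  define w where "w n M = upper_ext ?Y (A n) M (f n) - L n M" for n M
  define t where "t n M = M (f n) - L n M" for n M
  \<comment> \<open>Row \<open>n\<close> of the values at the functions \<open>g\<close>. Its
    indices \<open>prod_encode (n, j)\<close> are at least \<open>n\<close>, so the interval at
    \<open>f n\<close> is fixed before any value of the row is prescribed.\<close>
  define s where "s n M = (\<lambda>j. M (g (prod_encode (n, j))))" for n and M :: "((('a \<Rightarrow> real) \<Rightarrow> real) \<Rightarrow> real) \<Rightarrow> real"
  define q where "q n M = absorb (w n M) (t n M) (s n M)" for n M
  define h where "h M = ((\<lambda>k. q (fst (prod_decode k)) M (snd (prod_decode k))), mu_OH X M)" for M
  \<comment> \<open>The interval at \<open>f m\<close> depends on \<open>M\<close> only through the
    values on \<open>A m\<close>. Decoding uses this for injectivity, and the successive choice of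
    values uses it for surjectivity.\<close>
  have agree: "L m M = L m M' \<and> w m M = w m M'" if "\<And>k. k \<in> A n \<Longrightarrow> M k = M' k" "m \<le> n" for m n M M'
  proof -
    have "\<And>k. k \<in> A m \<Longrightarrow> M k = M' k" using that A_sub by blast
    then show ?thesis
      unfolding L_def w_def by (simp add: lower_ext_cong[of "A m" M M'] upper_ext_cong[OF cone(1), of m M M'])
  qed
  have t_bounds: "0 \<le> t n M" "t n M \<le> w n M" if "M \<in> OH_set ?Y" for n M
    using lower_ext_le_self[OF Y(1) cone(1) that f] upper_ext_ge_self[OF Y(1) cone(1) that f]
    by (simp_all add: t_def w_def L_def)
  have g_bounds: "M (g n) \<in> {0..1}" if "M \<in> OH_set ?Y" for M n
    using OH_set_ge_const[OF that g(1), of 0 n] OH_set_le_const[OF that g(1), of n 1] g(2) by simp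
  then have s_cube: "s n M \<in> cube" if "M \<in> OH_set ?Y" for n M
    using that by (simp add: s_def)
  have cont: "continuous_map ?Z (prod_topology Hilbert_cube ?Y) h"
  proof -
    have L_cont: "continuous_map ?Z euclideanreal (L n)"
      and U_cont: "continuous_map ?Z euclideanreal (\<lambda>M. upper_ext ?Y (A n) M (f n))" for n
      unfolding L_def A_def
      by (intro continuous_map_ext_span; use f g(1) in auto)+
    have ev: "continuous_map ?Z euclideanreal (\<lambda>M. M k)" if "k \<in> CX ?Y" for k
      by (rule continuous_map_OH_eval[OF Y that])
    have w_cont: "continuous_map ?Z euclideanreal (w n)" for n
      unfolding w_def by (intro continuous_map_diff U_cont L_cont)
    have t_cont: "continuous_map ?Z euclideanreal (t n)" for n
      unfolding t_def by (intro continuous_map_diff L_cont ev f)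
    have s_cont: "continuous_map ?Z euclidean (s n)" for n
      unfolding s_def euclidean_product_topology[symmetric] continuous_map_componentwise_UNIV
      by (intro allI ev g(1))
    have wts: "continuous_map ?Z euclidean (\<lambda>M. (w n M, t n M, s n M))" for n
      unfolding prod_topology_euclidean[symmetric]
      by (intro continuous_map_pairedI w_cont t_cont s_cont)
    have q_cont: "continuous_map ?Z euclideanreal (\<lambda>M. q n M j)" for n j
    proof -
      have "continuous_map ?Z (top_of_set {(w, t, s). 0 \<le> t \<and> t \<le> w \<and> s \<in> cube}) (\<lambda>M. (w n M, t n M, s n M))"
        using wts t_bounds s_cube by (auto simp: continuous_map_in_subtopology topZ)
      from continuous_map_compose[OF this, of euclideanreal "\<lambda>(w, t, s). absorb w t s j"]
      show ?thesis using continuous_on_absorb[of j] by (simp add: o_def q_def)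
    qed
    have q_cube: "q n M j \<in> {0..1}" if "M \<in> OH_set ?Y" for n M j
    proof -
      have "q n M \<in> cube" unfolding q_def
        using t_bounds[OF that, of n] s_cube[OF that] by (intro absorb_in_cube) auto
      then show ?thesis by blast
    qed
    show ?thesis
      unfolding h_def
    proof (intro continuous_map_pairedI)
      show "continuous_map ?Z Hilbert_cube (\<lambda>M k. q (fst (prod_decode k)) M (snd (prod_decode k)))"
        unfolding Hilbert_cube_def continuous_map_componentwise_UNIV continuous_map_in_subtopology
        using q_cont q_cube by (auto simp: topZ)
      show "continuous_map ?Z ?Y (mu_OH X)" by (rule continuous_map_mu_OH)
    qed
  qed
  have inj: "inj_on h (topspace ?Z)"
  proof (rule inj_onI)
    fix M M' assume "M \<in> topspace ?Z" "M' \<in> topspace ?Z" and eq: "h M = h M'"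
    then have M: "M \<in> OH_set ?Y" "M' \<in> OH_set ?Y" by (simp_all add: topZ)
    have mu: "mu_OH X M = mu_OH X M'" using eq by (simp add: h_def)
    have q_eq: "q n M = q n M'" for n
    proof
      fix j
      have "fst (h M) = fst (h M')" using eq by simp
      from fun_cong[OF this, of "prod_encode (n, j)"] show "q n M j = q n M' j" by (simp add: h_def)
    qed
    have "M (f n) = M' (f n) \<and> s n M = s n M'" for n
    proof (induction n rule: less_induct)
      case (less n)
      \<comment> \<open>\<open>m < n\<close> places \<open>g m\<close> in a row with index at most
        \<open>m\<close>, hence strictly before row \<open>n\<close>.\<close>
      have "M (g m) = M' (g m)" if "m < n" for m
      proof -
        obtain a b where ab: "m = prod_encode (a, b)" by (metis prod_decode_inverse surj_pair)
        then have "a < n" using that le_prod_encode_1[of a b] by simp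
        then have "s a M b = s a M' b" using less.IH by simp
        then show ?thesis by (simp add: s_def ab)
      qed
      then have A_eq: "M k = M' k" if "k \<in> A n" for k
        using span_cong[OF M mu _ _ that[unfolded A_def]] f g(1) less.IH by auto
      have Lw: "L n M = L n M'" "w n M = w n M'" using agree[OF A_eq order_refl] by simp_all
      \<comment> \<open>With equal widths, injectivity recovers the value at \<open>f n\<close> and
        all of row \<open>n\<close> at once, including values at \<open>g k\<close> with
        \<open>k > n\<close>.\<close>
      have "absorb (w n M) (t n M) (s n M) = absorb (w n M) (t n M') (s n M')"
        using q_eq[of n] by (simp add: q_def Lw)
      then have "t n M = t n M' \<and> s n M = s n M'"
        using t_bounds[OF M(1), of n] t_bounds[OF M(2), of n] Lw(2)
        by (intro absorb_inj[where w = "w n M"]) simp_all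
      then show ?case by (simp add: t_def Lw)
    qed
    then show "M = M'" by (intro determined M) simp
  qed
  have surj: "topspace (prod_topology Hilbert_cube ?Y) \<subseteq> h ` topspace ?Z"
  proof
    fix x assume "x \<in> topspace (prod_topology Hilbert_cube ?Y)"
    then obtain r \<nu> where x: "x = (r, \<nu>)" and r: "r \<in> cube" and \<nu>: "\<nu> \<in> OH_set X"
      by (cases x) (auto simp: topspace_Hilbert_cube topY)
    define R where "R n = (\<lambda>j. r (prod_encode (n, j)))" for n
    have R: "R n \<in> cube" for n using r by (simp add: R_def)
    define solves where "solves n u ts \<longleftrightarrow> 0 \<le> fst ts \<and> fst ts \<le> u \<and> snd ts \<in> cube
        \<and> absorb u (fst ts) (snd ts) = R n" for n u ts
    \<comment> \<open>A preimage of row \<open>R n\<close> that depends on the functional through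
      the width alone, so equal widths give equal prescriptions.\<close>
    define ts where "ts n u = (SOME ts. solves n u ts)" for n u
    have ts: "0 \<le> fst (ts n u) \<and> fst (ts n u) \<le> u \<and> snd (ts n u) \<in> cube
        \<and> absorb u (fst (ts n u)) (snd (ts n u)) = R n" if u: "0 \<le> u" for n u
    proof -
      obtain t s where "0 \<le> t" "t \<le> u" "s \<in> cube" "absorb u t s = R n" by (rule absorb_surj[OF u R])
      then have "solves n u (t, s)" by (simp add: solves_def)
      then have "solves n u (ts n u)" unfolding ts_def by (rule someI)
      then show ?thesis by (simp only: solves_def)
    qed
    \<comment> \<open>The value at \<open>g n\<close> is prescribed by row
      \<open>fst (prod_decode n)\<close>; as this index is at most \<open>n\<close>, the width of
      that row is known by then.\<close>
    define good where "good n M \<longleftrightarrow> M (f n) = L n M + fst (ts n (w n M)) \<and>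
      M (g n) = snd (ts (fst (prod_decode n)) (w (fst (prod_decode n)) M)) (snd (prod_decode n))" for n M
    have w_ge: "0 \<le> w n M" if "M \<in> OH_set ?Y" for n M using t_bounds[OF that, of n] by linarith
    have dec: "fst (prod_decode n) \<le> n" for n
      using le_prod_encode_1[of "fst (prod_decode n)" "snd (prod_decode n)"] by simp
    \<comment> \<open>Two successive extensions: \<open>f n\<close> gets a value inside its
      interval, then \<open>g n\<close> gets one in \<open>[0,1]\<close>, which is always
      admissible. Both leave the values on \<open>A n\<close> untouched, hence also the widths up to
      index \<open>n\<close>.\<close>
    have step: "\<exists>M'. M' \<in> OH_set ?Y \<and> (\<forall>k\<in>A n. M' k = M k) \<and> good n M'" if M: "M \<in> OH_set ?Y" for n M
    proof -
      let ?v = "L n M + fst (ts n (w n M))"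
      have "lower_ext ?Y (A n) M (f n) \<le> ?v" "?v \<le> upper_ext ?Y (A n) M (f n)"
        using ts[OF w_ge[OF M], of n n] by (simp_all add: L_def[symmetric] w_def)
      from extend_with_value[OF Y(1) cone(1) M f this]
      obtain M1 where M1: "M1 \<in> OH_set ?Y" "\<And>k. k \<in> A n \<Longrightarrow> M1 k = M k" "M1 (f n) = ?v" by blast
      let ?a = "fst (prod_decode n)" and ?b = "snd (prod_decode n)"
      let ?u = "snd (ts ?a (w ?a M1)) ?b"
      have "0 \<le> ?u" "?u \<le> 1" using ts[OF w_ge[OF M1(1)], of ?a ?a] by auto
      then have "lower_ext ?Y (A' n) M1 (g n) \<le> ?u" "?u \<le> upper_ext ?Y (A' n) M1 (g n)"
        using lower_ext_free[OF Y(1) cone(2) M1(1) g(1) free[of n, folded A'_def]] by simp_all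
      from extend_with_value[OF Y(1) cone(2) M1(1) g(1) this]
      obtain M2 where M2: "M2 \<in> OH_set ?Y" "\<And>k. k \<in> A' n \<Longrightarrow> M2 k = M1 k" "M2 (g n) = ?u" by blast
      have M2_1: "M2 k = M1 k" if "k \<in> A n" for k using M2(2) A_A' that by blast
      have M2_0: "M2 k = M k" if "k \<in> A n" for k using M2_1[OF that] M1(2)[OF that] by simp
      have "good n M2"
        unfolding good_def
        using M2(2)[OF fA'] M1(3) M2(3) agree[OF M2_0 order_refl] agree[OF M2_1 dec] by simp
      then show ?thesis using M2(1) M2_0 by blast
    qed
    \<comment> \<open>\<open>mu_OH\<close> sends the Dirac functional at \<open>\<nu>\<close> to
      \<open>\<nu>\<close>; later extensions keep its values on the evaluations, which lie in every
      \<open>A n\<close>.\<close>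
    have dirac: "dirac ?Y \<nu> \<in> OH_set ?Y" using \<nu> by (intro dirac_OH_set) (simp add: topY)
    have "\<exists>Ms. \<forall>n. (Ms n \<in> OH_set ?Y \<and> (n = 0 \<longrightarrow> Ms n = dirac ?Y \<nu>)) \<and>
        ((\<forall>k\<in>A n. Ms (Suc n) k = Ms n k) \<and> good n (Ms (Suc n)))"
    proof (rule dependent_nat_choice)
      show "\<exists>M. M \<in> OH_set ?Y \<and> (0 = 0 \<longrightarrow> M = dirac ?Y \<nu>)" using dirac by simp
      show "\<exists>M'. (M' \<in> OH_set ?Y \<and> (Suc n = 0 \<longrightarrow> M' = dirac ?Y \<nu>)) \<and> ((\<forall>k\<in>A n. M' k = M k) \<and> good n M')"
        if "M \<in> OH_set ?Y \<and> (n = 0 \<longrightarrow> M = dirac ?Y \<nu>)" for M n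
        using step[of M n] that by simp
    qed
    then obtain Ms where "\<forall>n. (Ms n \<in> OH_set ?Y \<and> (n = 0 \<longrightarrow> Ms n = dirac ?Y \<nu>)) \<and>
        ((\<forall>k\<in>A n. Ms (Suc n) k = Ms n k) \<and> good n (Ms (Suc n)))" by (rule exE)
    then have Ms: "\<And>n. Ms n \<in> OH_set ?Y" "Ms 0 = dirac ?Y \<nu>" "\<And>n k. k \<in> A n \<Longrightarrow> Ms (Suc n) k = Ms n k"
      "\<And>n. good n (Ms (Suc n))" by simp_all
    \<comment> \<open>In general no single \<open>Ms n\<close> solves all equations. Values on
      \<open>A n\<close> are final from \<open>Ms n\<close> on, so these sets decrease, and
      compactness yields a functional with all the final values.\<close>
    define C where "C n = {M \<in> topspace ?Z. \<forall>k\<in>A n. M k = Ms n k}" for n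
    have "(\<Inter>n. C n) \<noteq> {}"
    proof (rule compact_space_imp_nest)
      show "compact_space ?Z" by (rule OH_eq(3)[OF Y])
      show "closedin ?Z (C n)" for n
      proof -
        have "C n = (\<Inter>k\<in>A n. {M \<in> topspace ?Z. M k \<in> {Ms n k}})"
          using affine_cone_const[OF cone(1)] by (auto simp: C_def)
        also have "closedin ?Z \<dots>"
        proof (rule closedin_INT)
          show "A n \<noteq> {}" using affine_cone_const[OF cone(1)] by blast
          show "closedin ?Z {M \<in> topspace ?Z. M k \<in> {Ms n k}}" if "k \<in> A n" for k
            by (rule closedin_continuous_map_preimage[OF continuous_map_OH_eval[OF Y affine_cone_CX[OF cone(1) that]]]) simp
        qed
        finally show ?thesis .
      qed
      show "C n \<noteq> {}" for n using Ms(1) by (auto simp: C_def topZ)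
      show "decseq C"
      proof (rule decseq_SucI)
        show "C (Suc n) \<subseteq> C n" for n
          using A_sub[of n "Suc n"] Ms(3)[of _ n] by (auto simp: C_def subset_iff)
      qed
    qed
    then obtain M where MC: "\<And>n. M \<in> C n" by blast
    then have M: "M \<in> OH_set ?Y" "\<And>n k. k \<in> A n \<Longrightarrow> M k = Ms n k" by (auto simp: C_def topZ)
    have good: "good n M" for n
    proof -
      have eq: "M k = Ms (Suc n) k" if "k \<in> A (Suc n)" for k by (rule M(2)[OF that])
      show ?thesis
        using Ms(4)[of n] eq[OF fA[of n]] eq[OF gA[of n]] agree[OF eq le_SucI[OF order_refl]] agree[OF eq le_SucI[OF dec]]
        unfolding good_def by simp
    qed
    have q: "q n M = R n" for n
    proof -
      have "t n M = fst (ts n (w n M))" using good[of n] by (simp add: good_def t_def)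
      moreover have "s n M = snd (ts n (w n M))"
      proof
        fix j show "s n M j = snd (ts n (w n M)) j"
          using good[of "prod_encode (n, j)"] by (simp add: good_def s_def)
      qed
      ultimately show ?thesis using ts[OF w_ge[OF M(1)], of n n] by (simp add: q_def)
    qed
    have "mu_OH X M \<phi> = \<nu> \<phi>" if \<phi>: "\<phi> \<in> CX X" for \<phi>
    proof -
      have "evaluation X \<phi> \<in> A 0" using \<phi> by (simp add: A_def ray_span_def)
      from M(2)[OF this] show ?thesis
        using \<phi> \<nu> by (simp add: Ms(2) mu_OH_def evaluation_CX evaluation_apply)
    qed
    then have "mu_OH X M = \<nu>" using OH_set_eqI[OF mu_OH_in_OH_set[OF M(1)] \<nu>] by blast
    then have "h M = x" by (simp add: h_def q R_def x)
    then show "x \<in> h ` topspace ?Z" using M(1) by (auto simp: topZ)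
  qed
  have "homeomorphic_map ?Z (prod_topology Hilbert_cube ?Y) h"
  proof (rule continuous_imp_homeomorphic_map[OF cont OH_eq(3)[OF Y] _ _ inj])
    show "Hausdorff_space (prod_topology Hilbert_cube ?Y)"
      using OH_eq(4)[OF compact_X nonempty_X]
      by (simp add: Hausdorff_space_prod_topology Hilbert_cube_def Hausdorff_space_product_topology Hausdorff_space_subtopology)
    show "h ` topspace ?Z = topspace (prod_topology Hilbert_cube ?Y)"
      using surj continuous_map_image_subset_topspace[OF cont] by blast
  qed
  then show ?thesis
    unfolding Q_fibration_def by (intro exI[of _ h] conjI) (simp_all add: h_def)
qed

end

theorem mainTheorem3:
  fixes X :: "'a topology"
  assumes "compact_space X" and "Hausdorff_space X" and "metrizable_space X"
    and "\<exists>x\<in>topspace X. \<exists>y\<in>topspace X. x \<noteq> y"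
  shows "Q_fibration (OH (OH X)) (OH X) (mu_OH X)"
proof -
  obtain D where "separating X D" "countable D"
    by (rule metrizable_imp_countable_separating[OF assms(1,3)])
  then interpret separated_compact X D
    using assms(1,4) by unfold_locales auto
  show ?thesis by (rule Q_fibration_mu_OH)
qed

end
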